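(* Let $M$ be a finite m-cov random measure over $\mathbb{R}^d$ with covariance measure $C_M$. Let $(X_n)_{n\in\mathbb{N}}$ be a sequence of pairwise uncorrelated real random variables with variances $\sigma_{X_n}^2$ satisfying $\sum_n\sigma_{X_n}^2<\infty$, and let $(\mu_n)_{n\in\mathbb{N}}$ be a linearly independent sequence of finite measures over $\mathbb{R}^d$, such that $\langle M,\varphi\rangle=\sum_{n}X_n\langle\mu_n,\varphi\rangle$ in mean-square for every bounded Borel measurable $\varphi:\mathbb{R}^d\to\mathbb{R}$. Then for every bounded Borel measurable $\varphi:\mathbb{R}^d\to\mathbb{R}$, $$\Big|\,\langle C_M,\varphi\otimes\,\cdot\,\rangle-\sum_{j\le n}\sigma_{X_j}^2\langle\mu_j,\varphi\rangle\,\mu_j\,\Big|(\mathbb{R}^d)\to0\quad\text{as }n\to\infty,$$ where $\langle C_M,\varphi\otimes\,\cdot\,\rangle$ denotes the measure $B\mapsto\langle C_M,\varphi\otimes\mathbf{1}_B\rangle$ and $|\cdot|(\mathbb{R}^d)$ is the total variation.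
   Context: All random variables are real and defined on a common probability space $(\Omega,\mathcal{A},\mathbb{P})$. $\mathcal{B}(\mathbb{R}^d)$ denotes the Borel $\sigma$-algebra and $\mathcal{B}_B(\mathbb{R}^d)$ the $\delta$-ring of bounded Borel sets. A measure over $\mathbb{R}^d$ is a real-valued (signed) $\sigma$-additive function $\mu:\mathcal{B}_B(\mathbb{R}^d)\to\mathbb{R}$; $|\mu|$ is its total variation measure, the smallest positive measure with $|\mu(A)|\le|\mu|(A)$ for all $A\in\mathcal{B}_B(\mathbb{R}^d)$. $\mu$ is finite if $|\mu|(\mathbb{R}^d)<\infty$, in which case it extends uniquely and $\sigma$-additively to $\mathcal{B}(\mathbb{R}^d)$. $\langle\mu,\varphi\rangle=\int_{\mathbb{R}^d}\varphi\,d\mu$. A (centred measure-covariance second-order) random measure, called m-cov random measure, over $\mathbb{R}^d$ is a zero-mean stochastic process $M=(M(A))_{A\in\mathcal{B}_B(\mathbb{R}^d)}$ for which there is a measure $C_M$ over $\mathbb{R}^d\times\mathbb{R}^d$ (the covariance measure) with $\mathbb{E}(M(A)M(B))=C_M(A\times B)$ for all $A,B\in\mathcal{B}_B(\mathbb{R}^d)$. $M$ is finite if $C_M$ is finite. Write $(\varphi\otimes\phi)(x,y)=\varphi(x)\phi(y)$. For measurable $\varphi:\mathbb{R}^d\to\mathbb{R}$ with $\int|\varphi|\otimes|\varphi|\,d|C_M|<\infty$, $\langle M,\varphi\rangle=\int_{\mathbb{R}^d}\varphi(x)\,dM(x)\in L^2(\Omega,\mathcal{A},\mathbb{P})$ is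 the (Dunford–Schwartz) integral with respect to the $L^2(\Omega)$-valued measure $A\mapsto M(A)$: it is linear in $\varphi$, equals $M(A)$ for $\varphi=\mathbf{1}_A$, $A\in\mathcal{B}_B(\mathbb{R}^d)$, and is the $L^2(\Omega)$-limit of $\langle M,\varphi_n\rangle$ for any simple functions $\varphi_n$ (linear combinations of indicators of bounded Borel sets) with $\varphi_n\to\varphi$ pointwise and $|\varphi_n|\le|\varphi|$. One has $\mathbb{E}(\langle M,\varphi\rangle\langle M,\phi\rangle)=\langle C_M,\varphi\otimes\phi\rangle$. *)

theory Defs
  imports "HOL-Probability.Probability"
begin

section \<open>Signed measures on the bounded Borel sets\<close>

definition bounded_borel :: "'a::euclidean_space set set" where
  "bounded_borel = {A \<in> sets borel. bounded A}"

text \<open>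
  A signed measure is a real-valued set function on the delta-ring \<^const>\<open>bounded_borel\<close>.  It is
  represented by a total function on sets, whose values outside \<^const>\<open>bounded_borel\<close> are
  irrelevant to every notion below.  Taking all sets of the sequence empty gives
  \<open>\<mu> {} = 0\<close>.
\<close>

definition signed_measure :: "('a::euclidean_space set \<Rightarrow> real) \<Rightarrow> bool" where
  "signed_measure \<mu> \<longleftrightarrow>
     (\<forall>A :: nat \<Rightarrow> 'a set. range A \<subseteq> bounded_borel \<longrightarrow> disjoint_family A \<longrightarrow>
        (\<Union>i. A i) \<in> bounded_borel \<longrightarrow> (\<lambda>i. \<mu> (A i)) sums \<mu> (\<Union>i. A i))"

text \<open>
  The order on \<^typ>\<open>'a measure\<close> restricted to measures with the same measurable sets is the
  setwise order, so \<open>LEAST\<close> is literally ``the smallest positive measure''; that it exists is shown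
  in \<open>variation_least\<close> below.
\<close>

definition variation :: "('a::euclidean_space set \<Rightarrow> real) \<Rightarrow> 'a measure" where
  "variation \<mu> = (LEAST N. sets N = sets borel \<and>
     (\<forall>A\<in>bounded_borel. ennreal \<bar>\<mu> A\<bar> \<le> emeasure N A))"

definition finite_signed_measure :: "('a::euclidean_space set \<Rightarrow> real) \<Rightarrow> bool" where
  "finite_signed_measure \<mu> \<longleftrightarrow> signed_measure \<mu> \<and> emeasure (variation \<mu>) UNIV < \<infinity>"

text \<open>
  Jordan decomposition: the positive part is the smallest positive measure above \<open>\<mu>\<close>
  (\<^const>\<open>ennreal\<close> sends negative numbers to 0), the negative part is the positive part of
  \<open>-\<mu>\<close>.
\<close>

definition pos_part :: "('a::euclidean_space set \<Rightarrow> real) \<Rightarrow> 'a measure" where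
  "pos_part \<mu> = (LEAST N. sets N = sets borel \<and>
     (\<forall>A\<in>bounded_borel. ennreal (\<mu> A) \<le> emeasure N A))"

definition neg_part :: "('a::euclidean_space set \<Rightarrow> real) \<Rightarrow> 'a measure" where
  "neg_part \<mu> = pos_part (\<lambda>A. - \<mu> A)"

definition signed_integral :: "('a::euclidean_space set \<Rightarrow> real) \<Rightarrow> ('a \<Rightarrow> real) \<Rightarrow> real" where
  "signed_integral \<mu> \<phi> = (\<integral>x. \<phi> x \<partial>pos_part \<mu>) - (\<integral>x. \<phi> x \<partial>neg_part \<mu>)"

definition lin_indep_measures :: "(nat \<Rightarrow> 'a::euclidean_space set \<Rightarrow> real) \<Rightarrow> bool" where
  "lin_indep_measures \<mu> \<longleftrightarrow>
     (\<forall>J c. finite J \<longrightarrow> (\<forall>A\<in>bounded_borel. (\<Sum>j\<in>J. c j * \<mu> j A) = 0) \<longrightarrow> (\<forall>j\<in>J. c j = 0))"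

definition tensor :: "('a \<Rightarrow> real) \<Rightarrow> ('b \<Rightarrow> real) \<Rightarrow> 'a \<times> 'b \<Rightarrow> real" where
  "tensor \<phi> \<psi> = (\<lambda>(x, y). \<phi> x * \<psi> y)"

section \<open>Second-order random variables\<close>

definition L2 :: "'w measure \<Rightarrow> ('w \<Rightarrow> real) set" where
  "L2 P = {X \<in> borel_measurable P. integrable P (\<lambda>\<omega>. (X \<omega>)\<^sup>2)}"

definition mean_square_limit :: "'w measure \<Rightarrow> (nat \<Rightarrow> 'w \<Rightarrow> real) \<Rightarrow> ('w \<Rightarrow> real) \<Rightarrow> bool" where
  "mean_square_limit P Y Z \<longleftrightarrow> range Y \<subseteq> L2 P \<and> Z \<in> L2 P \<and>
     (\<lambda>n. prob_space.expectation P (\<lambda>\<omega>. (Y n \<omega> - Z \<omega>)\<^sup>2)) \<longlonglongrightarrow> 0"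

definition uncorrelated :: "'w measure \<Rightarrow> ('w \<Rightarrow> real) \<Rightarrow> ('w \<Rightarrow> real) \<Rightarrow> bool" where
  "uncorrelated P X Y \<longleftrightarrow>
     prob_space.expectation P (\<lambda>\<omega>. (X \<omega> - prob_space.expectation P X) *
                                   (Y \<omega> - prob_space.expectation P Y)) = 0"

section \<open>m-cov random measures\<close>

definition covariance_measure ::
    "'w measure \<Rightarrow> ('a::euclidean_space set \<Rightarrow> 'w \<Rightarrow> real) \<Rightarrow> (('a \<times> 'a) set \<Rightarrow> real) \<Rightarrow> bool" where
  "covariance_measure P M C \<longleftrightarrow> signed_measure C \<and>
     (\<forall>A\<in>bounded_borel. \<forall>B\<in>bounded_borel.
        prob_space.expectation P (\<lambda>\<omega>. M A \<omega> * M B \<omega>) = C (A \<times> B))"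

definition m_cov_random_measure ::
    "'w measure \<Rightarrow> ('a::euclidean_space set \<Rightarrow> 'w \<Rightarrow> real) \<Rightarrow> bool" where
  "m_cov_random_measure P M \<longleftrightarrow>
     (\<forall>A\<in>bounded_borel. M A \<in> L2 P \<and> prob_space.expectation P (M A) = 0) \<and>
     (\<exists>C. covariance_measure P M C)"

definition step_function :: "('a::euclidean_space \<Rightarrow> real) \<Rightarrow> bool" where
  "step_function s \<longleftrightarrow> simple_function borel s \<and> bounded {x. s x \<noteq> 0}"

text \<open>
  The canonical representation of a step function as a finite linear combination of indicators of
  bounded Borel sets; the value 0 is left out because its preimage is unbounded.
\<close>

definition step_integral ::
    "('a::euclidean_space set \<Rightarrow> 'w \<Rightarrow> real) \<Rightarrow> ('a \<Rightarrow> real) \<Rightarrow> 'w \<Rightarrow> real" where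
  "step_integral M s = (\<lambda>\<omega>. \<Sum>c\<in>range s - {0}. c * M (s -` {c}) \<omega>)"

text \<open>
  \<open>is_rm_integral P M \<phi> Y\<close> says that \<open>Y\<close> is a version of the Dunford--Schwartz integral of
  \<open>\<phi>\<close>.  Every Borel function is a pointwise limit of dominated step functions, so \<open>Y\<close> is
  determined up to almost sure equality; \<open>rm_integral\<close> picks one version.
\<close>

definition is_rm_integral ::
    "'w measure \<Rightarrow> ('a::euclidean_space set \<Rightarrow> 'w \<Rightarrow> real) \<Rightarrow> ('a \<Rightarrow> real) \<Rightarrow> ('w \<Rightarrow> real) \<Rightarrow> bool" where
  "is_rm_integral P M \<phi> Y \<longleftrightarrow> Y \<in> L2 P \<and>
     (\<forall>s :: nat \<Rightarrow> 'a \<Rightarrow> real.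
        (\<forall>n. step_function (s n)) \<longrightarrow> (\<forall>x. (\<lambda>n. s n x) \<longlonglongrightarrow> \<phi> x) \<longrightarrow>
        (\<forall>n x. \<bar>s n x\<bar> \<le> \<bar>\<phi> x\<bar>) \<longrightarrow>
        mean_square_limit P (\<lambda>n. step_integral M (s n)) Y)"

definition rm_integral ::
    "'w measure \<Rightarrow> ('a::euclidean_space set \<Rightarrow> 'w \<Rightarrow> real) \<Rightarrow> ('a \<Rightarrow> real) \<Rightarrow> 'w \<Rightarrow> real" where
  "rm_integral P M \<phi> = (SOME Y. is_rm_integral P M \<phi> Y)"

section \<open>Existence of the positive part and of the variation\<close>

lemma bounded_borel_Int: "A \<in> bounded_borel \<Longrightarrow> B \<in> sets borel \<Longrightarrow> A \<inter> B \<in> bounded_borel"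
  and bounded_borel_Diff: "A \<in> bounded_borel \<Longrightarrow> B \<in> sets borel \<Longrightarrow> A - B \<in> bounded_borel"
  and bounded_borel_Un: "A \<in> bounded_borel \<Longrightarrow> B \<in> bounded_borel \<Longrightarrow> A \<union> B \<in> bounded_borel"
  and bounded_borel_empty: "{} \<in> bounded_borel"
  and bounded_borel_sets: "A \<in> bounded_borel \<Longrightarrow> A \<in> sets borel"
  by (auto simp: bounded_borel_def bounded_Int bounded_diff)

lemma signed_measure_uminus: "signed_measure \<mu> \<Longrightarrow> signed_measure (\<lambda>A. - \<mu> A)"
  by (auto simp: signed_measure_def intro!: sums_minus)

lemma signed_measure_empty:
  assumes "signed_measure (\<mu> :: 'a::euclidean_space set \<Rightarrow> real)" shows "\<mu> {} = 0"
proof -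
  have "(\<lambda>i::nat. \<mu> {}) sums \<mu> {}"
    using assms[unfolded signed_measure_def, rule_format, of "\<lambda>_. {}"]
    by (auto simp: bounded_borel_empty disjoint_family_on_def)
  from summable_LIMSEQ_zero[OF sums_summable[OF this]] show ?thesis
    by (simp add: LIMSEQ_const_iff)
qed

lemma signed_measure_Un:
  assumes "signed_measure (\<mu> :: 'a::euclidean_space set \<Rightarrow> real)"
    and "A \<in> bounded_borel" "B \<in> bounded_borel" "A \<inter> B = {}"
  shows "\<mu> (A \<union> B) = \<mu> A + \<mu> B"
proof -
  have "(\<lambda>i. \<mu> (binaryset A B i)) sums \<mu> (A \<union> B)"
  proof -
    have "disjoint_family (binaryset A B)"
      using assms(4) by (auto simp: disjoint_family_on_def binaryset_def)
    then show ?thesis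
      using assms(1)[unfolded signed_measure_def, rule_format, of "binaryset A B"] assms(2,3)
      by (simp add: UN_binaryset_eq range_binaryset_eq bounded_borel_empty bounded_borel_Un)
  qed
  moreover have "(\<lambda>i. \<mu> (binaryset A B i)) sums (\<mu> A + \<mu> B)"
    by (rule binaryset_sums) (simp add: signed_measure_empty[OF assms(1)])
  ultimately show ?thesis by (rule sums_unique2)
qed

lemma measure_le_borel:
  assumes "sets N = sets borel" "sets N' = sets borel"
    and "\<And>A. A \<in> sets borel \<Longrightarrow> emeasure N A \<le> emeasure N' A"
  shows "N \<le> N'"
proof -
  have "space N = space N'" using assms(1,2) sets_eq_imp_space_eq by metis
  moreover have "emeasure N A \<le> emeasure N' A" for A
    using assms by (cases "A \<in> sets borel") (auto simp: emeasure_notin_sets)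
  ultimately show ?thesis using assms by (simp add: le_measure_iff le_fun_def)
qed

lemma pos_part_exists:
  fixes \<mu> :: "'a::euclidean_space set \<Rightarrow> real"
  assumes "signed_measure \<mu>"
  shows "\<exists>N. sets N = sets borel \<and>
    (\<forall>A\<in>sets borel. emeasure N A = (SUP B\<in>{B\<in>bounded_borel. B \<subseteq> A}. ennreal (\<mu> B)))"
proof -
  define f where "f A = (SUP B\<in>{B\<in>bounded_borel. B \<subseteq> A}. ennreal (\<mu> B))" for A
  have f_ge: "ennreal (\<mu> B) \<le> f A" if "B \<in> bounded_borel" "B \<subseteq> A" for A B
    unfolding f_def using that by (auto intro: SUP_upper)
  have f_mono: "f A \<le> f B" if "A \<subseteq> B" for A B
    unfolding f_def using that by (intro SUP_subset_mono) auto
  have f_Un: "f A + f B \<le> f (A \<union> B)" if "A \<inter> B = {}" for A B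
  proof -
    have "f A + ennreal (\<mu> E) \<le> f (A \<union> B)" if E: "E \<in> bounded_borel" "E \<subseteq> B" for E
    proof -
      have "ennreal (\<mu> D) + ennreal (\<mu> E) \<le> f (A \<union> B)" if D: "D \<in> bounded_borel" "D \<subseteq> A" for D
      proof (cases "\<mu> D \<ge> 0 \<and> \<mu> E \<ge> 0")
        case True
        then have "ennreal (\<mu> D) + ennreal (\<mu> E) = ennreal (\<mu> (D \<union> E))"
          by (subst signed_measure_Un[OF assms D(1) E(1)])
             (use D E \<open>A \<inter> B = {}\<close> in \<open>auto simp: ennreal_plus\<close>)
        also have "\<dots> \<le> f (A \<union> B)" using D E by (intro f_ge bounded_borel_Un) auto
        finally show ?thesis .
      next
        case False
        then consider "\<mu> D \<le> 0" | "\<mu> E \<le> 0" by linarith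
        then show ?thesis
          using f_ge[of D "A \<union> B"] f_ge[of E "A \<union> B"] D E by cases (auto simp: ennreal_neg)
      qed
      moreover have "{} \<in> {D\<in>bounded_borel. D \<subseteq> A}" by (simp add: bounded_borel_empty)
      ultimately show ?thesis
        unfolding f_def[of A] by (subst ennreal_SUP_add_left[symmetric]) (auto intro!: SUP_least)
    qed
    moreover have "{} \<in> {D\<in>bounded_borel. D \<subseteq> B}" by (simp add: bounded_borel_empty)
    ultimately show ?thesis
      unfolding f_def[of B] by (subst ennreal_SUP_add_right) (auto intro!: SUP_least)
  qed
  have f_empty: "f {} = 0"
    unfolding f_def by (auto intro!: antisym SUP_least simp: signed_measure_empty[OF assms])
  have ca: "countably_additive (sets borel) f"
    unfolding countably_additive_def
  proof (intro allI impI)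
    fix A :: "nat \<Rightarrow> 'a set"
    assume A: "range A \<subseteq> sets borel" "disjoint_family A" "(\<Union>i. A i) \<in> sets borel"
    have fin: "(\<Sum>i<n. f (A i)) \<le> f (\<Union>i<n. A i)" for n
    proof (induction n)
      case (Suc n)
      have "(\<Union>i<n. A i) \<inter> A n = {}"
        using A(2) by (auto simp: disjoint_family_on_def) (metis IntI empty_iff less_irrefl)
      from f_Un[OF this] Suc show ?case
        by (simp add: lessThan_Suc Un_commute add.commute) (meson add_left_mono order_trans)
    qed (simp add: f_empty)
    show "(\<Sum>i. f (A i)) = f (\<Union>i. A i)"
    proof (rule antisym)
      show "(\<Sum>i. f (A i)) \<le> f (\<Union>i. A i)"
        by (rule suminf_le_const[OF summableI]) (rule order_trans[OF fin f_mono], auto)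
      show "f (\<Union>i. A i) \<le> (\<Sum>i. f (A i))"
        unfolding f_def[of "\<Union>i. A i"]
      proof (rule SUP_least, clarify)
        fix B assume B: "B \<in> bounded_borel" "B \<subseteq> (\<Union>i. A i)"
        have BA: "B \<inter> A i \<in> bounded_borel" for i using A B by (auto intro: bounded_borel_Int)
        have eq: "(\<Union>i. B \<inter> A i) = B" using B by auto
        have s: "(\<lambda>i. \<mu> (B \<inter> A i)) sums \<mu> B"
          using assms[unfolded signed_measure_def, rule_format, of "\<lambda>i. B \<inter> A i"] BA A(2) B
          unfolding eq by (auto simp: disjoint_family_on_def)
        show "ennreal (\<mu> B) \<le> (\<Sum>i. f (A i))"
        proof (rule LIMSEQ_le_const2)
          show "(\<lambda>n. ennreal (\<Sum>i<n. \<mu> (B \<inter> A i))) \<longlonglongrightarrow> ennreal (\<mu> B)"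
            using s by (intro tendsto_ennrealI) (simp add: sums_def)
          have "ennreal (\<Sum>i<n. \<mu> (B \<inter> A i)) \<le> (\<Sum>i. f (A i))" for n
          proof -
            have "ennreal (\<Sum>i<n. \<mu> (B \<inter> A i)) \<le> ennreal (\<Sum>i<n. max 0 (\<mu> (B \<inter> A i)))"
              by (intro ennreal_leI sum_mono) auto
            also have "\<dots> = (\<Sum>i<n. ennreal (max 0 (\<mu> (B \<inter> A i))))"
              by (rule sum_ennreal[symmetric]) simp
            also have "\<dots> = (\<Sum>i<n. ennreal (\<mu> (B \<inter> A i)))"
              by (intro sum.cong refl) (auto simp: max_def ennreal_neg)
            also have "\<dots> \<le> (\<Sum>i<n. f (A i))" using BA by (intro sum_mono f_ge) auto
            also have "\<dots> \<le> (\<Sum>i. f (A i))" by (rule sum_le_suminf) auto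
            finally show ?thesis .
          qed
          then show "\<exists>N. \<forall>n\<ge>N. ennreal (\<Sum>i<n. \<mu> (B \<inter> A i)) \<le> (\<Sum>i. f (A i))" by blast
        qed
      qed
    qed
  qed
  have "emeasure (measure_of UNIV (sets borel) f) A = f A" if "A \<in> sets borel" for A :: "'a set"
    using that ca sets.sigma_algebra_axioms[of "borel :: 'a measure"]
    by (intro emeasure_measure_of_sigma) (auto simp: positive_def f_empty)
  moreover have "sets (measure_of UNIV (sets borel) f) = sets (borel :: 'a measure)"
    using sets.sigma_sets_eq[of "borel :: 'a measure"] by (simp add: sets_measure_of_conv)
  ultimately show ?thesis unfolding f_def by blast
qed

lemma pos_part_least:
  fixes \<mu> :: "'a::euclidean_space set \<Rightarrow> real"
  assumes "signed_measure \<mu>"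
  shows sets_pos_part: "sets (pos_part \<mu>) = sets borel"
    and emeasure_pos_part: "\<And>A. A \<in> sets borel \<Longrightarrow>
      emeasure (pos_part \<mu>) A = (SUP B\<in>{B\<in>bounded_borel. B \<subseteq> A}. ennreal (\<mu> B))"
proof -
  obtain N where N: "sets N = sets borel"
    "\<And>A. A \<in> sets borel \<Longrightarrow> emeasure N A = (SUP B\<in>{B\<in>bounded_borel. B \<subseteq> A}. ennreal (\<mu> B))"
    using pos_part_exists[OF assms] by blast
  have "pos_part \<mu> = N"
    unfolding pos_part_def
  proof (rule Least_equality)
    show "sets N = sets borel \<and> (\<forall>A\<in>bounded_borel. ennreal (\<mu> A) \<le> emeasure N A)"
      using N by (auto simp: bounded_borel_sets intro!: SUP_upper)
    fix N' assume N': "sets N' = sets borel \<and> (\<forall>A\<in>bounded_borel. ennreal (\<mu> A) \<le> emeasure N' A)"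
    show "N \<le> N'"
    proof (rule measure_le_borel)
      fix A :: "'a set" assume A: "A \<in> sets borel"
      have "ennreal (\<mu> B) \<le> emeasure N' A" if "B \<in> bounded_borel" "B \<subseteq> A" for B
        using that N' A by (auto intro: order_trans[OF _ emeasure_mono])
      then show "emeasure N A \<le> emeasure N' A" using N A by (auto intro!: SUP_least)
    qed (use N N' in auto)
  qed
  with N show "sets (pos_part \<mu>) = sets borel"
    "\<And>A. A \<in> sets borel \<Longrightarrow>
      emeasure (pos_part \<mu>) A = (SUP B\<in>{B\<in>bounded_borel. B \<subseteq> A}. ennreal (\<mu> B))"
    by auto
qed

lemma variation_least:
  fixes \<mu> :: "'a::euclidean_space set \<Rightarrow> real"
  assumes "signed_measure \<mu>"
  shows sets_variation: "sets (variation \<mu>) = sets borel"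
    and variation_ge: "\<And>A. A \<in> bounded_borel \<Longrightarrow> ennreal \<bar>\<mu> A\<bar> \<le> emeasure (variation \<mu>) A"
    and variation_le: "\<And>N. sets N = sets borel \<Longrightarrow>
      (\<And>A. A \<in> bounded_borel \<Longrightarrow> ennreal \<bar>\<mu> A\<bar> \<le> emeasure N A) \<Longrightarrow> variation \<mu> \<le> N"
    and emeasure_variation: "\<And>A. A \<in> sets borel \<Longrightarrow>
      emeasure (variation \<mu>) A = emeasure (pos_part \<mu>) A + emeasure (neg_part \<mu>) A"
proof -
  note m = signed_measure_uminus[OF assms]
  let ?p = "pos_part \<mu>" and ?n = "neg_part \<mu>"
  have sets_p: "sets ?p = sets borel" and sets_n: "sets ?n = sets borel"
    using sets_pos_part[OF assms] sets_pos_part[OF m] by (auto simp: neg_part_def)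
  define N where "N = measure_of UNIV (sets borel) (\<lambda>A. emeasure ?p A + emeasure ?n A)"
  have sets_N: "sets N = sets borel"
    using sets.sigma_sets_eq[of "borel :: 'a measure"] by (simp add: N_def sets_measure_of_conv)
  have ca: "countably_additive (sets borel) (\<lambda>A. emeasure ?p A + emeasure ?n A)"
    unfolding countably_additive_def
    by (auto simp: suminf_add[symmetric] suminf_emeasure sets_p sets_n)
  have em: "emeasure N A = emeasure ?p A + emeasure ?n A" if "A \<in> sets borel" for A
    using that ca sets.sigma_algebra_axioms[of "borel :: 'a measure"] unfolding N_def
    by (intro emeasure_measure_of_sigma) (auto simp: positive_def)
  have ge: "ennreal \<bar>\<mu> A\<bar> \<le> emeasure N A" if A: "A \<in> bounded_borel" for A
  proof -
    have "ennreal (\<mu> A) \<le> emeasure ?p A" "ennreal (- \<mu> A) \<le> emeasure ?n A"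
      using A emeasure_pos_part[OF assms] emeasure_pos_part[OF m]
      by (auto simp: neg_part_def bounded_borel_sets intro!: SUP_upper)
    then have "ennreal (\<mu> A) + ennreal (- \<mu> A) \<le> emeasure N A"
      using A by (simp add: em bounded_borel_sets add_mono)
    then show ?thesis by (cases "\<mu> A \<ge> 0") (auto simp: ennreal_neg)
  qed
  have le: "N \<le> N'" if N': "sets N' = sets borel"
    "\<And>A. A \<in> bounded_borel \<Longrightarrow> ennreal \<bar>\<mu> A\<bar> \<le> emeasure N' A" for N'
  proof (rule measure_le_borel)
    fix A :: "'a set" assume A: "A \<in> sets borel"
    have *: "ennreal (\<mu> B) + ennreal (- \<mu> D) \<le> emeasure N' A"
      if B: "B \<in> bounded_borel" "B \<subseteq> A" and D: "D \<in> bounded_borel" "D \<subseteq> A" for B D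
    proof -
      have bb: "B - D \<in> bounded_borel" "D - B \<in> bounded_borel" "B \<inter> D \<in> bounded_borel"
        using B D by (auto intro: bounded_borel_Diff bounded_borel_Int bounded_borel_sets)
      have "\<mu> B = \<mu> (B - D) + \<mu> (B \<inter> D)" "\<mu> D = \<mu> (D - B) + \<mu> (B \<inter> D)"
      proof -
        have "B = (B - D) \<union> (B \<inter> D)" "D = (D - B) \<union> (B \<inter> D)" by auto
        moreover have "(B - D) \<inter> (B \<inter> D) = {}" "(D - B) \<inter> (B \<inter> D) = {}" by auto
        ultimately show "\<mu> B = \<mu> (B - D) + \<mu> (B \<inter> D)" "\<mu> D = \<mu> (D - B) + \<mu> (B \<inter> D)"
          using signed_measure_Un[OF assms bb(1,3)] signed_measure_Un[OF assms bb(2,3)] by metis+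
      qed
      note diff = this
      have k: "ennreal \<bar>\<mu> E\<bar> + ennreal \<bar>\<mu> F\<bar> \<le> emeasure N' A"
        if "E \<in> bounded_borel" "F \<in> bounded_borel" "E \<inter> F = {}" "E \<subseteq> A" "F \<subseteq> A" for E F
      proof -
        have "ennreal \<bar>\<mu> E\<bar> + ennreal \<bar>\<mu> F\<bar> \<le> emeasure N' E + emeasure N' F"
          using that N' by (intro add_mono) auto
        also have "\<dots> = emeasure N' (E \<union> F)"
          using that N' by (intro plus_emeasure) (auto simp: bounded_borel_sets)
        also have "\<dots> \<le> emeasure N' A" using that N' A by (intro emeasure_mono) auto
        finally show ?thesis .
      qed
      have k1: "ennreal (\<mu> B) \<le> emeasure N' A" "ennreal (- \<mu> D) \<le> emeasure N' A"
      proof -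
        have "ennreal (\<mu> B) \<le> ennreal \<bar>\<mu> B\<bar>" "ennreal (- \<mu> D) \<le> ennreal \<bar>\<mu> D\<bar>"
          by (auto intro!: ennreal_leI)
        moreover have "ennreal \<bar>\<mu> B\<bar> \<le> emeasure N' A" "ennreal \<bar>\<mu> D\<bar> \<le> emeasure N' A"
          using k[OF B(1) bounded_borel_empty _ B(2)] k[OF D(1) bounded_borel_empty _ D(2)]
          by (auto simp: signed_measure_empty[OF assms])
        ultimately show "ennreal (\<mu> B) \<le> emeasure N' A" "ennreal (- \<mu> D) \<le> emeasure N' A"
          by (blast intro: order_trans)+
      qed
      have k2: "ennreal (\<mu> B - \<mu> D) \<le> emeasure N' A"
      proof -
        have "ennreal (\<mu> B - \<mu> D) \<le> ennreal (\<bar>\<mu> (B - D)\<bar> + \<bar>\<mu> (D - B)\<bar>)"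
          using diff by (intro ennreal_leI) linarith
        also have "\<dots> \<le> emeasure N' A" using k[OF bb(1,2)] B D by auto
        finally show ?thesis .
      qed
      show ?thesis
      proof (cases "\<mu> B \<ge> 0 \<and> - \<mu> D \<ge> 0")
        case True
        then show ?thesis using k2 by (simp flip: ennreal_plus)
      next
        case False
        then show ?thesis using k1 by (cases "\<mu> B \<ge> 0") (auto simp: ennreal_neg)
      qed
    qed
    have ne: "{} \<in> {B\<in>bounded_borel. B \<subseteq> A}" by (simp add: bounded_borel_empty)
    have "(SUP B\<in>{B\<in>bounded_borel. B \<subseteq> A}. ennreal (\<mu> B)) +
          (SUP D\<in>{B\<in>bounded_borel. B \<subseteq> A}. ennreal (- \<mu> D)) \<le> emeasure N' A"
    proof -
      have "(SUP B\<in>{B\<in>bounded_borel. B \<subseteq> A}. ennreal (\<mu> B)) + ennreal (- \<mu> D) \<le> emeasure N' A"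
        if "D \<in> {B\<in>bounded_borel. B \<subseteq> A}" for D
        using * that ne by (subst ennreal_SUP_add_left[symmetric]) (auto intro!: SUP_least)
      then show ?thesis
        using ne by (subst ennreal_SUP_add_right) (auto intro!: SUP_least)
    qed
    then show "emeasure N A \<le> emeasure N' A"
      using A by (simp add: em emeasure_pos_part[OF assms] emeasure_pos_part[OF m] neg_part_def)
  qed (use sets_N N' in auto)
  have eq: "variation \<mu> = N"
    unfolding variation_def by (rule Least_equality) (use sets_N ge le in auto)
  show "sets (variation \<mu>) = sets borel"
    "\<And>A. A \<in> bounded_borel \<Longrightarrow> ennreal \<bar>\<mu> A\<bar> \<le> emeasure (variation \<mu>) A"
    "\<And>N. sets N = sets borel \<Longrightarrow>
      (\<And>A. A \<in> bounded_borel \<Longrightarrow> ennreal \<bar>\<mu> A\<bar> \<le> emeasure N A) \<Longrightarrow> variation \<mu> \<le> N"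
    "\<And>A. A \<in> sets borel \<Longrightarrow>
      emeasure (variation \<mu>) A = emeasure (pos_part \<mu>) A + emeasure (neg_part \<mu>) A"
    using sets_N ge le em by (auto simp: eq)
qed

lemma finite_pos_part:
  assumes "finite_signed_measure (\<mu> :: 'a::euclidean_space set \<Rightarrow> real)"
  shows "finite_measure (pos_part \<mu>)" and "finite_measure (neg_part \<mu>)"
proof -
  have m: "signed_measure \<mu>" and f: "emeasure (variation \<mu>) UNIV < \<infinity>"
    using assms by (auto simp: finite_signed_measure_def)
  have sp: "space (pos_part \<mu>) = UNIV" "space (neg_part \<mu>) = UNIV"
    using sets_eq_imp_space_eq[OF sets_pos_part[OF m]]
      sets_eq_imp_space_eq[OF sets_pos_part[OF signed_measure_uminus[OF m]]]
    by (auto simp: neg_part_def)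
  have "emeasure (pos_part \<mu>) UNIV + emeasure (neg_part \<mu>) UNIV < \<infinity>"
    using f emeasure_variation[OF m, of UNIV] by simp
  then show "finite_measure (pos_part \<mu>)" "finite_measure (neg_part \<mu>)"
    by (auto intro!: finite_measureI simp: sp)
qed

lemma jordan_decomposition:
  assumes \<mu>: "finite_signed_measure (\<mu> :: 'a::euclidean_space set \<Rightarrow> real)"
    and A: "A \<in> bounded_borel"
  shows "measure (pos_part \<mu>) A - measure (neg_part \<mu>) A = \<mu> A"
proof -
  have *: "measure (pos_part \<nu>) A \<le> \<nu> A + measure (neg_part \<nu>) A"
    if \<nu>: "signed_measure \<nu>" "finite_measure (pos_part \<nu>)" "finite_measure (neg_part \<nu>)"
    for \<nu> :: "'a set \<Rightarrow> real"
  proof -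
    have le: "\<nu> B \<le> \<nu> A + measure (neg_part \<nu>) A" if B: "B \<in> bounded_borel" "B \<subseteq> A" for B
    proof -
      have AB: "A - B \<in> bounded_borel" using A B by (auto intro: bounded_borel_Diff bounded_borel_sets)
      have "\<nu> (B \<union> (A - B)) = \<nu> B + \<nu> (A - B)" by (rule signed_measure_Un[OF \<nu>(1) B(1) AB]) auto
      moreover have "B \<union> (A - B) = A" using B by auto
      moreover have "ennreal (- \<nu> (A - B)) \<le> emeasure (neg_part \<nu>) A"
        using emeasure_pos_part[OF signed_measure_uminus[OF \<nu>(1)]] A AB
        by (auto simp: neg_part_def bounded_borel_sets intro!: SUP_upper)
      then have "- \<nu> (A - B) \<le> measure (neg_part \<nu>) A"
        using finite_measure.emeasure_eq_measure[OF \<nu>(3)] by (simp add: ennreal_le_iff)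
      ultimately show ?thesis by simp
    qed
    from le[OF bounded_borel_empty] have 0: "0 \<le> \<nu> A + measure (neg_part \<nu>) A"
      by (simp add: signed_measure_empty[OF \<nu>(1)])
    have "emeasure (pos_part \<nu>) A \<le> ennreal (\<nu> A + measure (neg_part \<nu>) A)"
      using le A by (auto simp: emeasure_pos_part[OF \<nu>(1)] bounded_borel_sets
          intro!: SUP_least ennreal_leI)
    then show ?thesis
      using 0 finite_measure.emeasure_eq_measure[OF \<nu>(2)] by (simp add: ennreal_le_iff)
  qed
  have m: "signed_measure \<mu>" using \<mu> by (simp add: finite_signed_measure_def)
  have nn: "neg_part (\<lambda>A. - \<mu> A) = pos_part \<mu>" by (simp add: neg_part_def)
  show ?thesis
    using *[OF m finite_pos_part[OF \<mu>]]
      *[OF signed_measure_uminus[OF m], unfolded nn neg_part_def[symmetric],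
        OF finite_pos_part(2)[OF \<mu>] finite_pos_part(1)[OF \<mu>]]
    by linarith
qed

lemma signed_integral_indicator:
  assumes "finite_signed_measure (\<mu> :: 'a::euclidean_space set \<Rightarrow> real)" "A \<in> bounded_borel"
  shows "signed_integral \<mu> (indicator A) = \<mu> A"
proof -
  have m: "signed_measure \<mu>" using assms by (simp add: finite_signed_measure_def)
  have "space (pos_part \<mu>) = UNIV" "space (neg_part \<mu>) = UNIV"
    using sets_eq_imp_space_eq[OF sets_pos_part[OF m]]
      sets_eq_imp_space_eq[OF sets_pos_part[OF signed_measure_uminus[OF m]]]
    by (auto simp: neg_part_def)
  then show ?thesis
    using jordan_decomposition[OF assms] by (simp add: signed_integral_def)
qed

end

theory Submission
  imports Defs
begin

text \<open>
  With \<open>G = \<langle>M, g\<rangle>\<close> for a step function \<open>g\<close>, the signed measure in question evaluated at a bounded Borel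
  set \<open>B\<close> is the \<open>L\<^sup>2\<close> inner product of \<open>M(B)\<close> with the residual \<open>G - (\<Sum>j\<le>n. (X\<^sub>j - E X\<^sub>j) \<langle>\<mu>\<^sub>j, g\<rangle>)\<close>.
  As \<open>E M(B)\<^sup>2 = C(B \<times> B)\<close> is at most the total variation of \<open>C\<close>, the Cauchy--Schwarz inequality makes
  its convergence to 0 uniform in \<open>B\<close>, which is convergence in total variation.  By Bessel's inequality
  the residual is no larger than \<open>G\<close>, whose squared norm is \<open>\<langle>C, g \<otimes> g\<rangle>\<close>; hence an error of
  approximation of \<open>\<phi>\<close> by step functions is controlled uniformly in \<open>n\<close> and \<open>B\<close>, and the general case
  follows by dominated convergence.
\<close>

section \<open>Bounded Borel functions and signed integrals\<close>

definition bounded_borel_fun :: "('a::euclidean_space \<Rightarrow> real) \<Rightarrow> bool" where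
  "bounded_borel_fun f \<longleftrightarrow> f \<in> borel_measurable borel \<and> bounded (range f)"

lemma bounded_borel_funI:
  assumes "f \<in> borel_measurable borel" "\<And>x. \<bar>f x\<bar> \<le> b"
  shows "bounded_borel_fun f"
  using assms by (auto simp: bounded_borel_fun_def bounded_iff)

lemma bounded_borel_funE:
  assumes "bounded_borel_fun f"
  obtains b where "f \<in> borel_measurable borel" "\<And>x. \<bar>f x\<bar> \<le> b"
  using assms by (auto simp: bounded_borel_fun_def bounded_iff)

lemma bounded_borel_fun_zero [intro, simp]: "bounded_borel_fun (\<lambda>_. 0)"
  by (rule bounded_borel_funI[where b = 0]) auto

lemma bounded_borel_fun_indicator [intro]:
  "A \<in> sets borel \<Longrightarrow> bounded_borel_fun (indicator A)"
  by (rule bounded_borel_funI[where b = 1]) (auto simp: indicator_def)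

lemma bounded_borel_fun_add [intro]:
  assumes "bounded_borel_fun f" "bounded_borel_fun g"
  shows "bounded_borel_fun (\<lambda>x. f x + g x)"
proof -
  obtain b c where *: "f \<in> borel_measurable borel" "\<And>x. \<bar>f x\<bar> \<le> b"
    "g \<in> borel_measurable borel" "\<And>x. \<bar>g x\<bar> \<le> c"
    using assms by (elim bounded_borel_funE) (rule that)
  show ?thesis
    by (rule bounded_borel_funI[where b = "b + c"])
       (use * in \<open>auto intro: order_trans[OF abs_triangle_ineq add_mono]\<close>)
qed

lemma bounded_borel_fun_cmult [intro]:
  assumes "bounded_borel_fun f"
  shows "bounded_borel_fun (\<lambda>x. c * f x)"
proof -
  obtain b where *: "f \<in> borel_measurable borel" "\<And>x. \<bar>f x\<bar> \<le> b"
    using assms by (elim bounded_borel_funE) (rule that)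
  show ?thesis
    by (rule bounded_borel_funI[where b = "\<bar>c\<bar> * b"])
       (use * in \<open>auto simp: abs_mult intro: mult_left_mono\<close>)
qed

lemma measurable_tensor:
  fixes f g :: "'a::euclidean_space \<Rightarrow> real"
  assumes "f \<in> borel_measurable borel" "g \<in> borel_measurable borel"
  shows "tensor f g \<in> borel_measurable borel"
proof -
  have "(\<lambda>z. f (fst z) * g (snd z)) \<in> borel_measurable (borel \<Otimes>\<^sub>M borel)"
    using assms by measurable
  then show ?thesis
    by (simp add: tensor_def case_prod_beta borel_prod)
qed

lemma abs_tensor_le:
  assumes "\<And>x. \<bar>f x\<bar> \<le> b" "\<And>x. \<bar>g x\<bar> \<le> c"
  shows "\<bar>tensor f g z\<bar> \<le> b * c"
proof -
  \<comment> \<open>\<open>mult_mono\<close> requires a nonnegative \<open>b\<close>; the bound at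
    any single point provides it.\<close>
  have "0 \<le> b" using assms(1)[of undefined] by linarith
  then show ?thesis
    using assms by (auto simp: tensor_def case_prod_beta abs_mult intro!: mult_mono)
qed

lemma bounded_borel_fun_tensor [intro]:
  fixes f g :: "'a::euclidean_space \<Rightarrow> real"
  assumes "bounded_borel_fun f" "bounded_borel_fun g"
  shows "bounded_borel_fun (tensor f g)"
proof -
  obtain b c where *: "f \<in> borel_measurable borel" "\<And>x. \<bar>f x\<bar> \<le> b"
    "g \<in> borel_measurable borel" "\<And>x. \<bar>g x\<bar> \<le> c"
    using assms by (elim bounded_borel_funE) (rule that)
  show ?thesis
    by (rule bounded_borel_funI[where b = "b * c"])
       (use * in \<open>auto intro!: measurable_tensor abs_tensor_le\<close>)
qed

lemma tensor_simps:
  "tensor (\<lambda>x. f x + g x) h = (\<lambda>z. tensor f h z + tensor g h z)"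
  "tensor h (\<lambda>x. f x + g x) = (\<lambda>z. tensor h f z + tensor h g z)"
  "tensor (\<lambda>x. c * f x) h = (\<lambda>z. c * tensor f h z)"
  "tensor h (\<lambda>x. c * f x) = (\<lambda>z. c * tensor h f z)"
  "tensor (\<lambda>_. 0) h = (\<lambda>_. 0)"
  "tensor h (\<lambda>_. 0) = (\<lambda>_. 0)"
  by (auto simp: tensor_def algebra_simps)

lemma tensor_indicator: "tensor (indicator A) (indicator B) = indicator (A \<times> B)"
  by (auto simp: tensor_def indicator_def)

lemma bounded_borel_Times:
  fixes A B :: "'a::euclidean_space set"
  assumes "A \<in> bounded_borel" "B \<in> bounded_borel"
  shows "A \<times> B \<in> bounded_borel"
  using assms by (auto simp: bounded_borel_def bounded_Times borel_Times)

section \<open>Integration against a fixed finite signed measure\<close>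

context
  fixes \<mu> :: "'a::euclidean_space set \<Rightarrow> real"
  assumes \<mu>: "finite_signed_measure \<mu>"
begin

private lemma sets_parts: "sets (pos_part \<mu>) = sets borel" "sets (neg_part \<mu>) = sets borel"
  using \<mu> sets_pos_part[of \<mu>] sets_pos_part[OF signed_measure_uminus, of \<mu>]
  by (simp_all add: finite_signed_measure_def neg_part_def)

private lemma measurable_parts:
  "borel_measurable (pos_part \<mu>) = (borel_measurable borel :: ('a \<Rightarrow> real) set)"
  "borel_measurable (neg_part \<mu>) = (borel_measurable borel :: ('a \<Rightarrow> real) set)"
  using sets_parts by (auto intro!: measurable_cong_sets)

private lemma integrable_parts:
  assumes "bounded_borel_fun f"
  shows "integrable (pos_part \<mu>) f" "integrable (neg_part \<mu>) f"
proof -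
  obtain b where b: "f \<in> borel_measurable borel" "\<And>x. \<bar>f x\<bar> \<le> b"
    using assms by (elim bounded_borel_funE) (rule that)
  interpret p: finite_measure "pos_part \<mu>" by (rule finite_pos_part[OF \<mu>])
  interpret n: finite_measure "neg_part \<mu>" by (rule finite_pos_part[OF \<mu>])
  show "integrable (pos_part \<mu>) f"
    by (rule p.integrable_const_bound[where B = b]) (use b in \<open>auto simp: measurable_parts\<close>)
  show "integrable (neg_part \<mu>) f"
    by (rule n.integrable_const_bound[where B = b]) (use b in \<open>auto simp: measurable_parts\<close>)
qed

lemma signed_integral_add:
  "bounded_borel_fun f \<Longrightarrow> bounded_borel_fun g \<Longrightarrow>
    signed_integral \<mu> (\<lambda>x. f x + g x) = signed_integral \<mu> f + signed_integral \<mu> g"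
  by (simp add: signed_integral_def integrable_parts)

lemma signed_integral_cmult: "signed_integral \<mu> (\<lambda>x. c * f x) = c * signed_integral \<mu> f"
  by (simp add: signed_integral_def algebra_simps)

text \<open>Both Jordan parts are finite, so the constant \<open>b\<close> is an integrable majorant
  for each, and dominated convergence applies to them separately.\<close>

lemma signed_integral_bounded_convergence:
  assumes "\<And>n. f n \<in> borel_measurable borel" "\<And>n x. \<bar>f n x\<bar> \<le> b"
    "\<And>x. (\<lambda>n. f n x) \<longlonglongrightarrow> g x"
  shows "(\<lambda>n. signed_integral \<mu> (f n)) \<longlonglongrightarrow> signed_integral \<mu> g"
proof -
  interpret p: finite_measure "pos_part \<mu>" by (rule finite_pos_part[OF \<mu>])
  interpret n: finite_measure "neg_part \<mu>" by (rule finite_pos_part[OF \<mu>])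
  have "g \<in> borel_measurable borel"
    by (rule borel_measurable_LIMSEQ_real[OF assms(3,1)])
  then have m: "g \<in> borel_measurable (pos_part \<mu>)" "g \<in> borel_measurable (neg_part \<mu>)"
    "\<And>n. f n \<in> borel_measurable (pos_part \<mu>)" "\<And>n. f n \<in> borel_measurable (neg_part \<mu>)"
    using assms(1) by (simp_all only: measurable_parts)
  show ?thesis
    unfolding signed_integral_def
    by (intro tendsto_diff integral_dominated_convergence[where w = "\<lambda>_. b"] m
        p.integrable_const n.integrable_const AE_I2)
       (simp_all only: real_norm_def assms)
qed

text \<open>Finiteness of the variation matters here: only then does the real-valued
  \<open>measure\<close> agree with \<open>emeasure\<close> on \<open>UNIV\<close>.\<close>

lemma abs_signed_measure_le: "A \<in> bounded_borel \<Longrightarrow> \<bar>\<mu> A\<bar> \<le> measure (variation \<mu>) UNIV"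
proof -
  assume A: "A \<in> bounded_borel"
  have m: "signed_measure \<mu>" and fin: "emeasure (variation \<mu>) UNIV < \<infinity>"
    using \<mu> by (auto simp: finite_signed_measure_def)
  have "ennreal \<bar>\<mu> A\<bar> \<le> emeasure (variation \<mu>) A" by (rule variation_ge[OF m A])
  also have "\<dots> \<le> emeasure (variation \<mu>) UNIV"
    by (rule emeasure_mono) (auto simp: sets_variation[OF m])
  also have "\<dots> = ennreal (measure (variation \<mu>) UNIV)"
    using fin by (simp add: emeasure_eq_ennreal_measure)
  finally show ?thesis by (simp add: ennreal_le_iff)
qed

end

lemma signed_integral_zero [simp]: "signed_integral \<mu> (\<lambda>_. 0) = 0"
  by (simp add: signed_integral_def)

section \<open>Signed measures obtained by fixing one factor, and bounds on total variation\<close>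

text \<open>Finite additivity is linearity in the indicator; countable additivity then follows by
  bounded convergence along the partial unions.\<close>

lemma signed_measure_tensor_indicator:
  fixes C :: "('a::euclidean_space \<times> 'a) set \<Rightarrow> real"
  assumes C: "finite_signed_measure C" and \<phi>: "bounded_borel_fun \<phi>"
  shows "signed_measure (\<lambda>B. signed_integral C (tensor \<phi> (indicator B)))"
  unfolding signed_measure_def
proof (intro allI impI)
  fix A :: "nat \<Rightarrow> 'a set"
  assume A: "range A \<subseteq> bounded_borel" "disjoint_family A" "(\<Union>i. A i) \<in> bounded_borel"
  obtain b where b: "\<phi> \<in> borel_measurable borel" "\<And>x. \<bar>\<phi> x\<bar> \<le> b"
    using \<phi> by (elim bounded_borel_funE) (rule that)
  have Ab: "A i \<in> sets borel" for i using A(1) bounded_borel_sets by blast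
  have fin: "(\<Sum>i<n. signed_integral C (tensor \<phi> (indicator (A i)))) =
      signed_integral C (tensor \<phi> (indicator (\<Union>i<n. A i)))" for n
  proof (induction n)
    case 0
    show ?case by (simp add: tensor_def case_prod_beta)
  next
    case (Suc n)
    have "A n \<inter> A i = {}" if "i < n" for i
      using A(2) that by (simp add: disjoint_family_on_def)
    then have "indicator (\<Union>i<Suc n. A i) =
        (\<lambda>x. indicator (\<Union>i<n. A i) x + indicator (A n) x :: real)"
      by (auto simp: lessThan_Suc fun_eq_iff indicator_def)
    moreover have "(\<Union>i<n. A i) \<in> sets borel" using Ab by auto
    then have "signed_integral C
        (\<lambda>z. tensor \<phi> (indicator (\<Union>i<n. A i)) z + tensor \<phi> (indicator (A n)) z) =
      signed_integral C (tensor \<phi> (indicator (\<Union>i<n. A i))) +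
      signed_integral C (tensor \<phi> (indicator (A n)))"
      by (intro signed_integral_add[OF C] bounded_borel_fun_tensor bounded_borel_fun_indicator \<phi> Ab)
    ultimately show ?case
      using Suc by (simp only: tensor_simps sum.lessThan_Suc)
  qed
  have lim: "(\<lambda>n. tensor \<phi> (indicator (\<Union>i<n. A i)) z) \<longlonglongrightarrow> tensor \<phi> (indicator (\<Union>i. A i)) z" for z
    unfolding tensor_def case_prod_beta by (intro tendsto_intros LIMSEQ_indicator_UN)
  show "(\<lambda>i. signed_integral C (tensor \<phi> (indicator (A i)))) sums
      signed_integral C (tensor \<phi> (indicator (\<Union>i. A i)))"
    unfolding sums_def fin
  proof (rule signed_integral_bounded_convergence[OF C _ _ lim])
    show "tensor \<phi> (indicator (\<Union>i<n. A i)) \<in> borel_measurable borel" for n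
      using Ab b by (intro measurable_tensor borel_measurable_indicator) auto
    show "\<bar>tensor \<phi> (indicator (\<Union>i<n. A i)) z\<bar> \<le> b * 1" for n z
      by (rule abs_tensor_le) (use b in \<open>auto simp: indicator_def\<close>)
  qed
qed

lemma signed_measure_diff_sum:
  assumes "signed_measure \<nu>" "\<And>j. j \<in> J \<Longrightarrow> signed_measure (\<mu> j)"
  shows "signed_measure (\<lambda>B. \<nu> B - (\<Sum>j\<in>J. c j * \<mu> j B))"
  using assms unfolding signed_measure_def
  by (auto intro!: sums_diff sums_sum sums_mult)

text \<open>The masses of the positive and negative parts are suprema of \<open>\<nu>\<close> and
  \<open>-\<nu>\<close> over bounded Borel sets, so each is at most \<open>\<epsilon>\<close>; their
  sum accounts for the factor 2. This turns uniform smallness on sets into smallness in total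
  variation.\<close>

lemma variation_UNIV_le:
  assumes \<nu>: "signed_measure \<nu>" and le: "\<And>B. B \<in> bounded_borel \<Longrightarrow> \<bar>\<nu> B\<bar> \<le> \<epsilon>"
  shows "emeasure (variation \<nu>) UNIV \<le> ennreal (2 * \<epsilon>)"
proof -
  have e: "0 \<le> \<epsilon>" using le[OF bounded_borel_empty] by linarith
  have 1: "\<nu> B \<le> \<epsilon>" and 2: "- \<nu> B \<le> \<epsilon>" if "B \<in> bounded_borel" for B using le[OF that] by auto
  have "emeasure (pos_part \<nu>) UNIV \<le> ennreal \<epsilon>"
    using 1 by (subst emeasure_pos_part[OF \<nu>]) (auto intro!: SUP_least ennreal_leI)
  moreover have "emeasure (neg_part \<nu>) UNIV \<le> ennreal \<epsilon>"
    unfolding neg_part_def using 2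
    by (subst emeasure_pos_part[OF signed_measure_uminus[OF \<nu>]]) (auto intro!: SUP_least ennreal_leI)
  ultimately have "emeasure (variation \<nu>) UNIV \<le> ennreal \<epsilon> + ennreal \<epsilon>"
    by (subst emeasure_variation[OF \<nu>]) (auto intro: add_mono)
  then show ?thesis using e by (simp flip: ennreal_plus)
qed

section \<open>Square-integrable random variables\<close>

text \<open>Functions are not identified up to null sets, so on \<open>L2 P\<close> this is a
  positive semidefinite form, and norm 0 means vanishing almost surely.\<close>

definition L2_inner :: "'w measure \<Rightarrow> ('w \<Rightarrow> real) \<Rightarrow> ('w \<Rightarrow> real) \<Rightarrow> real" where
  "L2_inner P X Y = (\<integral>\<omega>. X \<omega> * Y \<omega> \<partial>P)"

lemma L2_inner_commute: "L2_inner P X Y = L2_inner P Y X"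
  by (simp add: L2_inner_def mult.commute)

lemma L2_inner_self: "L2_inner P X X = (\<integral>\<omega>. (X \<omega>)\<^sup>2 \<partial>P)"
  by (simp add: L2_inner_def power2_eq_square)

lemma L2_inner_self_nonneg: "0 \<le> L2_inner P X X"
  by (simp add: L2_inner_self)

lemma L2_integrable_mult:
  assumes "X \<in> L2 P" "Y \<in> L2 P"
  shows "integrable P (\<lambda>\<omega>. X \<omega> * Y \<omega>)"
proof (rule Bochner_Integration.integrable_bound)
  show "integrable P (\<lambda>\<omega>. (X \<omega>)\<^sup>2 + (Y \<omega>)\<^sup>2)" using assms by (simp add: L2_def)
  show "(\<lambda>\<omega>. X \<omega> * Y \<omega>) \<in> borel_measurable P" using assms by (auto simp: L2_def)
  have "\<bar>x * y\<bar> \<le> x\<^sup>2 + y\<^sup>2" for x y :: real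
    using sum_squares_bound[of "\<bar>x\<bar>" "\<bar>y\<bar>"] zero_le_power2[of x] zero_le_power2[of y]
    unfolding abs_mult power2_abs by linarith
  then show "AE \<omega> in P. norm (X \<omega> * Y \<omega>) \<le> norm ((X \<omega>)\<^sup>2 + (Y \<omega>)\<^sup>2)"
    by (simp add: abs_of_nonneg)
qed

lemma L2_zero [simp, intro]: "(\<lambda>_. 0) \<in> L2 P"
  by (simp add: L2_def)

lemma L2_cmult [intro]: "X \<in> L2 P \<Longrightarrow> (\<lambda>\<omega>. c * X \<omega>) \<in> L2 P"
  by (auto simp: L2_def power_mult_distrib)

lemma L2_add [intro]:
  assumes "X \<in> L2 P" "Y \<in> L2 P"
  shows "(\<lambda>\<omega>. X \<omega> + Y \<omega>) \<in> L2 P"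
  using assms L2_integrable_mult[OF assms]
  by (auto simp: L2_def power2_sum mult.assoc)

lemma L2_diff [intro]:
  assumes "X \<in> L2 P" "Y \<in> L2 P"
  shows "(\<lambda>\<omega>. X \<omega> - Y \<omega>) \<in> L2 P"
  using L2_add[OF assms(1) L2_cmult[OF assms(2), of "-1"]] by simp

lemma L2_sum [intro]:
  assumes "\<And>j. j \<in> J \<Longrightarrow> Y j \<in> L2 P"
  shows "(\<lambda>\<omega>. \<Sum>j\<in>J. Y j \<omega>) \<in> L2 P"
  using assms by (induction J rule: infinite_finite_induct) auto

lemma (in prob_space) L2_const [simp, intro]: "(\<lambda>_. c) \<in> L2 M"
  by (simp add: L2_def)

lemma (in prob_space) L2_integrable: "X \<in> L2 M \<Longrightarrow> integrable M X"
  using L2_integrable_mult[of X M "\<lambda>_. 1"] by simp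

lemma L2_inner_add_left:
  "X \<in> L2 P \<Longrightarrow> Y \<in> L2 P \<Longrightarrow> Z \<in> L2 P \<Longrightarrow>
    L2_inner P (\<lambda>\<omega>. X \<omega> + Y \<omega>) Z = L2_inner P X Z + L2_inner P Y Z"
  by (simp add: L2_inner_def distrib_right L2_integrable_mult)

lemma L2_inner_diff_left:
  "X \<in> L2 P \<Longrightarrow> Y \<in> L2 P \<Longrightarrow> Z \<in> L2 P \<Longrightarrow>
    L2_inner P (\<lambda>\<omega>. X \<omega> - Y \<omega>) Z = L2_inner P X Z - L2_inner P Y Z"
  by (simp add: L2_inner_def left_diff_distrib L2_integrable_mult)

lemma L2_inner_cmult_left: "L2_inner P (\<lambda>\<omega>. c * X \<omega>) Z = c * L2_inner P X Z"
  by (simp add: L2_inner_def mult.assoc)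

lemma L2_inner_sum_left:
  assumes "\<And>j. j \<in> J \<Longrightarrow> Y j \<in> L2 P" "Z \<in> L2 P"
  shows "L2_inner P (\<lambda>\<omega>. \<Sum>j\<in>J. Y j \<omega>) Z = (\<Sum>j\<in>J. L2_inner P (Y j) Z)"
  using assms by (simp add: L2_inner_def sum_distrib_right L2_integrable_mult)

lemma L2_Cauchy_Schwarz:
  assumes X: "X \<in> L2 P" and Y: "Y \<in> L2 P"
  shows "(L2_inner P X Y)\<^sup>2 \<le> L2_inner P X X * L2_inner P Y Y"
proof (cases "L2_inner P Y Y = 0")
  case True
  then have "AE \<omega> in P. (Y \<omega>)\<^sup>2 = 0"
    using Y by (subst (asm) L2_inner_self, subst (asm) integral_nonneg_eq_0_iff_AE)
      (auto simp: L2_def)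
  then have "AE \<omega> in P. X \<omega> * Y \<omega> = 0" by eventually_elim simp
  then have "L2_inner P X Y = 0" unfolding L2_inner_def by (rule integral_eq_zero_AE)
  then show ?thesis using True by simp
next
  case False
  define q r where "q = L2_inner P Y Y" and "r = L2_inner P X Y"
  have q: "0 < q" using False L2_inner_self_nonneg[of P Y] by (simp add: q_def)
  \<comment> \<open>\<open>Z\<close> is \<open>q\<close> times the component of \<open>X\<close>
    orthogonal to \<open>Y\<close>; scaling by \<open>q\<close> avoids division.\<close>
  define Z where "Z = (\<lambda>\<omega>. q * X \<omega> - r * Y \<omega>)"
  have Z: "Z \<in> L2 P" using X Y unfolding Z_def by auto
  have lin: "L2_inner P Z W = q * L2_inner P X W - r * L2_inner P Y W" if "W \<in> L2 P" for W
    unfolding Z_def using X Y that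
    by (subst L2_inner_diff_left) (auto simp: L2_inner_cmult_left)
  have "L2_inner P Z Z = q * (q * L2_inner P X X - r\<^sup>2)"
    using lin[OF Z] lin[OF X] lin[OF Y]
    by (simp add: L2_inner_commute[of P X Z] L2_inner_commute[of P Y Z]
        L2_inner_commute[of P Y X] q_def[symmetric] r_def[symmetric] power2_eq_square algebra_simps)
  then have "0 \<le> q * L2_inner P X X - r\<^sup>2"
    using L2_inner_self_nonneg[of P Z] q by (simp add: zero_le_mult_iff)
  then show ?thesis by (simp add: q_def r_def mult.commute)
qed

text \<open>This replaces the triangle inequality without square roots; the factor 2 is harmless
  wherever the terms tend to 0 or vanish.\<close>

lemma L2_inner_add_self_le:
  assumes "X \<in> L2 P" "Y \<in> L2 P"
  shows "L2_inner P (\<lambda>\<omega>. X \<omega> + Y \<omega>) (\<lambda>\<omega>. X \<omega> + Y \<omega>) \<le> 2 * L2_inner P X X + 2 * L2_inner P Y Y"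
proof -
  have "(x + y)\<^sup>2 \<le> 2 * x\<^sup>2 + 2 * y\<^sup>2" for x y :: real
    using sum_squares_bound[of x y] by (simp add: power2_sum)
  then have "(\<integral>\<omega>. (X \<omega> + Y \<omega>)\<^sup>2 \<partial>P) \<le> (\<integral>\<omega>. 2 * (X \<omega>)\<^sup>2 + 2 * (Y \<omega>)\<^sup>2 \<partial>P)"
    using assms L2_add[OF assms] by (intro integral_mono) (auto simp: L2_def)
  also have "\<dots> = 2 * L2_inner P X X + 2 * L2_inner P Y Y"
    using assms by (simp add: L2_inner_self L2_def)
  finally show ?thesis by (simp add: L2_inner_self)
qed

section \<open>Step functions and their stochastic integrals\<close>

text \<open>Relates a step function to its stochastic integral through an arbitrary representation
  by indicators. Linearity is thus immediate, whereas \<open>step_integral\<close> is tied to level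
  sets, which change under addition. A function may have several partners \<open>G\<close>; that
  they agree almost surely is never presupposed.\<close>

inductive step_pair ::
    "('a::euclidean_space set \<Rightarrow> 'w \<Rightarrow> real) \<Rightarrow> ('a \<Rightarrow> real) \<Rightarrow> ('w \<Rightarrow> real) \<Rightarrow> bool" for M where
  zero: "step_pair M (\<lambda>_. 0) (\<lambda>_. 0)"
| add: "step_pair M g G \<Longrightarrow> A \<in> bounded_borel \<Longrightarrow>
    step_pair M (\<lambda>x. g x + c * indicator A x) (\<lambda>\<omega>. G \<omega> + c * M A \<omega>)"

lemma step_pair_indicator:
  "A \<in> bounded_borel \<Longrightarrow> step_pair M (indicator A) (M A)"
  using step_pair.add[OF step_pair.zero, of A M 1] by simp

lemma step_pair_add_cmult:
  assumes "step_pair M h H" "step_pair M g G"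
  shows "step_pair M (\<lambda>x. g x + a * h x) (\<lambda>\<omega>. G \<omega> + a * H \<omega>)"
  using assms
proof (induction rule: step_pair.induct)
  case (add h H A c)
  from step_pair.add[OF add.IH[OF add.prems] add.hyps(2), of "a * c"]
  show ?case by (simp add: algebra_simps)
qed simp

lemma step_pair_diff:
  assumes "step_pair M h H" "step_pair M g G"
  shows "step_pair M (\<lambda>x. g x - h x) (\<lambda>\<omega>. G \<omega> - H \<omega>)"
  using step_pair_add_cmult[OF assms, of "-1"] by simp

lemma step_pair_sum:
  assumes "finite J" "\<And>j. j \<in> J \<Longrightarrow> A j \<in> bounded_borel"
  shows "step_pair M (\<lambda>x. \<Sum>j\<in>J. c j * indicator (A j) x) (\<lambda>\<omega>. \<Sum>j\<in>J. c j * M (A j) \<omega>)"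
  using assms
proof (induction J)
  case (insert i J)
  have "step_pair M (\<lambda>x. (\<Sum>j\<in>J. c j * indicator (A j) x) + c i * indicator (A i) x)
      (\<lambda>\<omega>. (\<Sum>j\<in>J. c j * M (A j) \<omega>) + c i * M (A i) \<omega>)"
    by (intro step_pair.add insert.IH insert.prems) auto
  then show ?case by (simp only: sum.insert[OF insert.hyps] add.commute)
qed (simp add: step_pair.zero)

lemma bounded_borel_fun_step_pair:
  assumes "step_pair M g G"
  shows "bounded_borel_fun g"
  using assms
  by induction
    (simp_all add: bounded_borel_fun_add bounded_borel_fun_cmult bounded_borel_fun_indicator
      bounded_borel_sets)

lemma step_pair_step_integral:
  fixes s :: "'a::euclidean_space \<Rightarrow> real"
  assumes "step_function s"
  shows "step_pair M s (step_integral M s)"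
proof -
  let ?I = "range s - {0}"
  have s: "simple_function borel s" "bounded {x. s x \<noteq> 0}"
    using assms by (auto simp: step_function_def)
  have fin: "finite ?I" using s(1) by (simp add: simple_function_def)
  have level: "s -` {c} \<in> bounded_borel" if "c \<in> ?I" for c
  proof -
    have "s -` {c} \<in> sets borel" using s(1) that by (auto simp: simple_function_def)
    moreover have "bounded (s -` {c})" using that by (intro bounded_subset[OF s(2)]) auto
    ultimately show ?thesis by (simp add: bounded_borel_def)
  qed
  \<comment> \<open>At most the term \<open>c = s x\<close> survives; if \<open>s x = 0\<close>
    there is none, and the sum has the right value 0.\<close>
  have "(\<Sum>c\<in>?I. c * indicator (s -` {c}) x) = s x" for x
  proof -
    have "(\<Sum>c\<in>?I. c * indicator (s -` {c}) x) = (\<Sum>c\<in>?I. if c = s x then c else 0)"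
      by (intro sum.cong) auto
    then show ?thesis using fin by auto
  qed
  then show ?thesis
    using step_pair_sum[where A = "\<lambda>c. s -` {c}" and c = "\<lambda>c. c" and M = M, OF fin level] by (simp only: step_integral_def)
qed

text \<open>Simple functions converging to \<open>\<phi>\<close> need not have bounded support, so
  they are cut off by balls of growing radius. One constant \<open>b\<close> serves for
  \<open>\<phi>\<close> and all approximants.\<close>

lemma step_pair_approximation:
  fixes \<phi> :: "'a::euclidean_space \<Rightarrow> real"
  assumes "bounded_borel_fun \<phi>"
  obtains g G b where "\<And>k. step_pair M (g k) (G k)" "\<And>k x. \<bar>g k x\<bar> \<le> b" "\<And>x. \<bar>\<phi> x\<bar> \<le> b"
    "\<And>x. (\<lambda>k. g k x) \<longlonglongrightarrow> \<phi> x"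
proof -
  obtain b where b: "\<phi> \<in> borel_measurable borel" "\<And>x. \<bar>\<phi> x\<bar> \<le> b"
    using assms by (elim bounded_borel_funE) (rule that)
  obtain F where F: "\<And>k. simple_function borel (F k)" "\<And>x. (\<lambda>k. F k x) \<longlonglongrightarrow> \<phi> x"
    \<comment> \<open>The metric approximation, with base point 0, controls the distance to 0 up to
      a factor 2; hence the final constant \<open>2 * b\<close>.\<close>
    "\<And>k x. \<bar>F k x\<bar> \<le> 2 * \<bar>\<phi> x\<bar>"
    using borel_measurable_implies_sequence_metric[OF b(1), of 0] by (auto simp: dist_real_def)
  define g :: "nat \<Rightarrow> 'a \<Rightarrow> real" where "g k = (\<lambda>x. F k x * indicator (ball 0 (real k)) x)" for k
  have step: "step_function (g k)" for k
  proof -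
    have "simple_function borel (g k)"
      unfolding g_def using F(1) by (intro simple_function_mult simple_function_indicator) auto
    moreover have "bounded {x. g k x \<noteq> 0}"
      by (rule bounded_subset[OF bounded_ball[of 0 "real k"]]) (auto simp: g_def indicator_def)
    ultimately show ?thesis by (simp add: step_function_def)
  qed
  have le: "\<bar>g k x\<bar> \<le> 2 * b" for k x
  proof -
    have "\<bar>g k x\<bar> \<le> \<bar>F k x\<bar>" by (simp add: g_def indicator_def)
    then show ?thesis using F(3)[of k x] b(2)[of x] by linarith
  qed
  have lim: "(\<lambda>k. g k x) \<longlonglongrightarrow> \<phi> x" for x
  proof -
    obtain m :: nat where m: "norm x < real m" using reals_Archimedean2 by blast
    have "\<forall>\<^sub>F k in sequentially. F k x = g k x"
      using eventually_ge_at_top[of m]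
      by eventually_elim (use m in \<open>auto simp: g_def indicator_def\<close>)
    then show ?thesis using F(2) by (rule Lim_transform_eventually[rotated])
  qed
  have "\<bar>\<phi> x\<bar> \<le> 2 * b" for x using b(2)[of x] by linarith
  with step_pair_step_integral[OF step] le show ?thesis using lim by (rule that)
qed

section \<open>The covariance measure as Gram kernel of the random measure\<close>

locale covariance_isometry = prob_space P
  for P :: "'w measure"
    and M :: "'a::euclidean_space set \<Rightarrow> 'w \<Rightarrow> real"
    and C :: "('a \<times> 'a) set \<Rightarrow> real" +
  assumes C_finite: "finite_signed_measure C"
    and M_L2: "A \<in> bounded_borel \<Longrightarrow> M A \<in> L2 P"
    and M_inner: "A \<in> bounded_borel \<Longrightarrow> B \<in> bounded_borel \<Longrightarrow> L2_inner P (M A) (M B) = C (A \<times> B)"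
begin

lemma step_pair_L2: "step_pair M g G \<Longrightarrow> G \<in> L2 P"
  by (induction rule: step_pair.induct) (simp_all add: M_L2 L2_add L2_cmult)

lemma step_pair_inner_indicator:
  assumes "step_pair M g G" "B \<in> bounded_borel"
  shows "L2_inner P G (M B) = signed_integral C (tensor g (indicator B))"
  using assms
proof (induction rule: step_pair.induct)
  case zero
  show ?case by (simp add: tensor_simps L2_inner_def)
next
  case (add g G A c)
  note bb = bounded_borel_fun_tensor bounded_borel_fun_cmult bounded_borel_fun_indicator
    bounded_borel_fun_step_pair[OF add.hyps(1)] bounded_borel_sets add
  have "L2_inner P (\<lambda>\<omega>. G \<omega> + c * M A \<omega>) (M B) =
      signed_integral C (tensor g (indicator B)) + c * C (A \<times> B)"
    using add step_pair_L2[OF add.hyps(1)]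
    by (simp add: L2_inner_add_left L2_inner_cmult_left M_L2 M_inner L2_cmult)
  also have "\<dots> = signed_integral C (tensor g (indicator B)) +
      signed_integral C (\<lambda>z. c * tensor (indicator A) (indicator B) z)"
    using add by (simp only: signed_integral_cmult[OF C_finite] tensor_indicator
        signed_integral_indicator[OF C_finite bounded_borel_Times])
  also have "\<dots> = signed_integral C
      (\<lambda>z. tensor g (indicator B) z + c * tensor (indicator A) (indicator B) z)"
    by (rule signed_integral_add[OF C_finite, symmetric]) (intro bb)+
  finally show ?case by (simp only: tensor_simps)
qed

text \<open>Bilinearity in two stages: the case of an indicator in the second factor is
  \<open>step_pair_inner_indicator\<close>, and the induction builds up \<open>h\<close>. The inner
  product therefore depends on \<open>g\<close> and \<open>h\<close> alone, whatever their
  partners.\<close>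

lemma step_pair_isometry:
  assumes "step_pair M h H" "step_pair M g G"
  shows "L2_inner P G H = signed_integral C (tensor g h)"
  using assms
proof (induction rule: step_pair.induct)
  case zero
  show ?case by (simp add: tensor_simps L2_inner_def)
next
  case (add h H A c)
  note bb = bounded_borel_fun_tensor bounded_borel_fun_cmult bounded_borel_fun_indicator
    bounded_borel_fun_step_pair[OF add.hyps(1)] bounded_borel_fun_step_pair[OF add.prems]
    bounded_borel_sets add
  have "L2_inner P G (\<lambda>\<omega>. H \<omega> + c * M A \<omega>) = L2_inner P G H + c * L2_inner P G (M A)"
    using add step_pair_L2[OF add.hyps(1)] step_pair_L2[OF add.prems]
    by (simp add: L2_inner_add_left L2_inner_cmult_left M_L2 L2_cmult L2_inner_commute[of P G])
  also have "\<dots> = signed_integral C (tensor g h) +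
      signed_integral C (\<lambda>z. c * tensor g (indicator A) z)"
    using add by (simp only: signed_integral_cmult[OF C_finite] step_pair_inner_indicator)
  also have "\<dots> = signed_integral C (\<lambda>z. tensor g h z + c * tensor g (indicator A) z)"
    by (rule signed_integral_add[OF C_finite, symmetric]) (intro bb)+
  finally show ?case by (simp only: tensor_simps)
qed

lemma tensor_bounded_convergence:
  assumes "\<And>k. f k \<in> borel_measurable borel" "\<And>k. g k \<in> borel_measurable borel"
    and "\<And>k x. \<bar>f k x\<bar> \<le> b" "\<And>k x. \<bar>g k x\<bar> \<le> c"
    and "\<And>x. (\<lambda>k. f k x) \<longlonglongrightarrow> f' x" "\<And>x. (\<lambda>k. g k x) \<longlonglongrightarrow> g' x"
  shows "(\<lambda>k. signed_integral C (tensor (f k) (g k))) \<longlonglongrightarrow> signed_integral C (tensor f' g')"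
proof (rule signed_integral_bounded_convergence[OF C_finite])
  show "tensor (f k) (g k) \<in> borel_measurable borel" for k
    by (intro measurable_tensor assms)
  show "\<bar>tensor (f k) (g k) z\<bar> \<le> b * c" for k z
    by (intro abs_tensor_le assms)
  show "(\<lambda>k. tensor (f k) (g k) z) \<longlonglongrightarrow> tensor f' g' z" for z
    unfolding tensor_def case_prod_beta by (intro tendsto_mult assms)
qed

section \<open>The stochastic integral of an indicator\<close>

text \<open>Provides the witness that makes the choice in \<open>rm_integral\<close> meaningful. The
  error \<open>s n - indicator A\<close> is itself a step function, bounded by 2 and tending to 0,
  so the isometry reduces mean-square convergence to bounded convergence under
  \<open>C\<close>.\<close>

lemma is_rm_integral_indicator:
  assumes A: "A \<in> bounded_borel"
  shows "is_rm_integral P M (indicator A) (M A)"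
  unfolding is_rm_integral_def
proof (intro conjI allI impI)
  show "M A \<in> L2 P" using A by (rule M_L2)
  fix s :: "nat \<Rightarrow> 'a \<Rightarrow> real"
  assume s: "\<forall>n. step_function (s n)" "\<forall>x. (\<lambda>n. s n x) \<longlonglongrightarrow> indicator A x"
    "\<forall>n x. \<bar>s n x\<bar> \<le> \<bar>indicator A x\<bar>"
  define d where "d n x = s n x - indicator A x" for n x
  define D where "D n \<omega> = step_integral M (s n) \<omega> - M A \<omega>" for n \<omega>
  have d: "step_pair M (d n) (D n)" for n
    unfolding d_def D_def
    using step_pair_diff[OF step_pair_indicator[OF A] step_pair_step_integral] s(1) by blast
  have db: "\<bar>d n x\<bar> \<le> 2" for n x
    using s(3)[rule_format, of n x]
    by (cases "x \<in> A") (auto simp: d_def indicator_def)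
  have dm: "d n \<in> borel_measurable borel" for n
    using bounded_borel_fun_step_pair[OF d] by (simp add: bounded_borel_fun_def)
  have dl: "(\<lambda>n. d n x) \<longlonglongrightarrow> 0" for x
    using tendsto_diff[OF s(2)[rule_format, of x] tendsto_const[of "indicator A x"]]
    by (simp add: d_def)
  have "(\<lambda>n. signed_integral C (tensor (d n) (d n))) \<longlonglongrightarrow> signed_integral C (tensor (\<lambda>_. 0) (\<lambda>_. 0))"
    by (rule tensor_bounded_convergence[OF dm dm db db dl dl])
  then have "(\<lambda>n. L2_inner P (D n) (D n)) \<longlonglongrightarrow> 0"
    by (simp add: step_pair_isometry[OF d d] tensor_simps)
  then show "mean_square_limit P (\<lambda>n. step_integral M (s n)) (M A)"
    using step_pair_L2[OF step_pair_step_integral] s(1) M_L2[OF A]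
    by (auto simp: mean_square_limit_def L2_inner_self D_def)
qed

text \<open>The chosen version is determined only almost surely, so it is compared with
  \<open>M A\<close> by \<open>L\<^sup>2\<close> distance rather than by equality of
  functions.\<close>

lemma rm_integral_indicator:
  assumes A: "A \<in> bounded_borel"
  shows "rm_integral P M (indicator A) \<in> L2 P"
    and "L2_inner P (\<lambda>\<omega>. rm_integral P M (indicator A) \<omega> - M A \<omega>)
           (\<lambda>\<omega>. rm_integral P M (indicator A) \<omega> - M A \<omega>) = 0"
proof -
  let ?Z = "rm_integral P M (indicator A)" and ?s = "indicator A :: 'a \<Rightarrow> real"
  have Z: "is_rm_integral P M (indicator A) ?Z"
    unfolding rm_integral_def by (rule someI[of "is_rm_integral P M (indicator A)", OF is_rm_integral_indicator[OF A]])
  then show ZL: "?Z \<in> L2 P" by (simp add: is_rm_integral_def)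
  have "simple_function borel ?s" using bounded_borel_sets[OF A] by (intro simple_function_indicator)
  moreover have "bounded {x. ?s x \<noteq> 0}" using A by (simp add: indicator_def bounded_borel_def)
  ultimately have step: "step_function ?s" by (simp add: step_function_def)
  let ?Y = "step_integral M ?s"
  have Y: "?Y \<in> L2 P" by (rule step_pair_L2[OF step_pair_step_integral[OF step]])
  \<comment> \<open>The constant sequence approximates \<open>1\<^sub>A\<close>, so both versions agree with its step integral.\<close>
  have *: "L2_inner P (\<lambda>\<omega>. ?Y \<omega> - W \<omega>) (\<lambda>\<omega>. ?Y \<omega> - W \<omega>) = 0"
    if "is_rm_integral P M (indicator A) W" for W
  proof -
    have "mean_square_limit P (\<lambda>n::nat. ?Y) W"
      using that[unfolded is_rm_integral_def, THEN conjunct2, rule_format, of "\<lambda>n::nat. ?s"] step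
      by simp
    then show ?thesis by (simp add: mean_square_limit_def L2_inner_self LIMSEQ_const_iff)
  qed
  have "L2_inner P (\<lambda>\<omega>. ?Z \<omega> - ?Y \<omega>) (\<lambda>\<omega>. ?Z \<omega> - ?Y \<omega>) = 0"
    using *[OF Z] by (simp add: L2_inner_self power2_commute)
  with *[OF is_rm_integral_indicator[OF A]]
    L2_inner_add_self_le[OF L2_diff[OF ZL Y] L2_diff[OF Y M_L2[OF A]]]
  show "L2_inner P (\<lambda>\<omega>. ?Z \<omega> - M A \<omega>) (\<lambda>\<omega>. ?Z \<omega> - M A \<omega>) = 0"
    using L2_inner_self_nonneg[of P "\<lambda>\<omega>. ?Z \<omega> - M A \<omega>"] by simp
qed

end

section \<open>Uncorrelated expansions\<close>

text \<open>\<open>Y j\<close> stands for the centred \<open>X j\<close>, and \<open>v j\<close> for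
  its variance. The expansion is stated for \<open>M A\<close> itself, free of any choice of
  version; step functions inherit it by linearity.\<close>

locale uncorrelated_expansion = covariance_isometry P M C
  for P :: "'w measure"
    and M :: "'a::euclidean_space set \<Rightarrow> 'w \<Rightarrow> real"
    and C :: "('a \<times> 'a) set \<Rightarrow> real" +
  fixes Y :: "nat \<Rightarrow> 'w \<Rightarrow> real"
    and v :: "nat \<Rightarrow> real"
    and \<mu> :: "nat \<Rightarrow> 'a set \<Rightarrow> real"
  assumes Y_L2: "Y j \<in> L2 P"
    and Y_inner: "L2_inner P (Y i) (Y j) = (if i = j then v j else 0)"
    and \<mu>_finite: "finite_signed_measure (\<mu> j)"
    and expansion: "A \<in> bounded_borel \<Longrightarrow>
      (\<lambda>n. L2_inner P (\<lambda>\<omega>. M A \<omega> - (\<Sum>j\<le>n. \<mu> j A * Y j \<omega>))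
                      (\<lambda>\<omega>. M A \<omega> - (\<Sum>j\<le>n. \<mu> j A * Y j \<omega>))) \<longlonglongrightarrow> 0"
begin

definition residual :: "nat \<Rightarrow> ('a \<Rightarrow> real) \<Rightarrow> ('w \<Rightarrow> real) \<Rightarrow> 'w \<Rightarrow> real" where
  "residual n g G = (\<lambda>\<omega>. G \<omega> - (\<Sum>j\<le>n. signed_integral (\<mu> j) g * Y j \<omega>))"

text \<open>With variances for \<open>v\<close>, this is the set function of the theorem. Unlike
  \<open>residual\<close> it involves no random variable, so it makes sense for a general bounded
  Borel function.\<close>

definition defect :: "nat \<Rightarrow> ('a \<Rightarrow> real) \<Rightarrow> 'a set \<Rightarrow> real" where
  "defect n g B = signed_integral C (tensor g (indicator B)) -
     (\<Sum>j\<le>n. v j * signed_integral (\<mu> j) g * \<mu> j B)"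

lemma v_nonneg: "0 \<le> v j"
  using L2_inner_self_nonneg[of P "Y j"] by (simp add: Y_inner)

lemma sum_L2: "(\<lambda>\<omega>. \<Sum>j\<le>n. c j * Y j \<omega>) \<in> L2 P"
  using Y_L2 by (intro L2_sum L2_cmult)

lemma residual_L2: "step_pair M g G \<Longrightarrow> residual n g G \<in> L2 P"
  unfolding residual_def by (intro L2_diff step_pair_L2 sum_L2)

lemma residual_inner:
  assumes "step_pair M g G" "Z \<in> L2 P"
  shows "L2_inner P (residual n g G) Z =
    L2_inner P G Z - (\<Sum>j\<le>n. signed_integral (\<mu> j) g * L2_inner P (Y j) Z)"
  using assms step_pair_L2[OF assms(1)] sum_L2[where c = "\<lambda>j. signed_integral (\<mu> j) g"]
  by (simp add: residual_def L2_inner_diff_left L2_inner_sum_left L2_inner_cmult_left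
      Y_L2 L2_cmult)

lemma residual_add_cmult:
  assumes "bounded_borel_fun g" "bounded_borel_fun h"
  shows "residual n (\<lambda>x. g x + c * h x) (\<lambda>\<omega>. G \<omega> + c * H \<omega>) =
    (\<lambda>\<omega>. residual n g G \<omega> + c * residual n h H \<omega>)"
  using assms
  by (simp add: residual_def signed_integral_add[OF \<mu>_finite] signed_integral_cmult[OF \<mu>_finite]
      bounded_borel_fun_cmult algebra_simps sum.distrib sum_distrib_left)

lemma residual_indicator_tendsto:
  assumes "A \<in> bounded_borel"
  shows "(\<lambda>n. L2_inner P (residual n (indicator A) (M A)) (residual n (indicator A) (M A))) \<longlonglongrightarrow> 0"
  using expansion[OF assms] by (simp add: residual_def signed_integral_indicator[OF \<mu>_finite assms])

text \<open>The residual is linear in the pair, so the convergence assumed for indicators propagates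
  along the inductive construction.\<close>

lemma residual_tendsto:
  assumes "step_pair M g G"
  shows "(\<lambda>n. L2_inner P (residual n g G) (residual n g G)) \<longlonglongrightarrow> 0"
  using assms
proof (induction rule: step_pair.induct)
  case zero
  show ?case by (simp add: residual_def L2_inner_def)
next
  case (add g G A c)
  let ?r = "\<lambda>n. residual n g G" and ?i = "\<lambda>n. residual n (indicator A) (M A)"
  have eq: "residual n (\<lambda>x. g x + c * indicator A x) (\<lambda>\<omega>. G \<omega> + c * M A \<omega>) =
      (\<lambda>\<omega>. ?r n \<omega> + c * ?i n \<omega>)" for n
    using add by (intro residual_add_cmult bounded_borel_fun_step_pair
        bounded_borel_fun_indicator bounded_borel_sets)
  have i: "?i n \<in> L2 P" for n
    by (rule residual_L2[OF step_pair_indicator[OF add.hyps(2)]])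
  have c: "L2_inner P (\<lambda>\<omega>. c * ?i n \<omega>) (\<lambda>\<omega>. c * ?i n \<omega>) = c\<^sup>2 * L2_inner P (?i n) (?i n)" for n
    by (simp add: L2_inner_self power_mult_distrib)
  show ?case
    unfolding eq
  proof (rule tendsto_sandwich[OF _ _ tendsto_const])
    show "(\<lambda>n. 2 * L2_inner P (?r n) (?r n) + 2 * (c\<^sup>2 * L2_inner P (?i n) (?i n))) \<longlonglongrightarrow> 0"
      using tendsto_add[OF tendsto_mult_left[OF add.IH, of 2]
          tendsto_mult_left[OF residual_indicator_tendsto[OF add.hyps(2)], of "2 * c\<^sup>2"]]
      by (simp add: mult.assoc)
    show "\<forall>\<^sub>F n in sequentially. L2_inner P (\<lambda>\<omega>. ?r n \<omega> + c * ?i n \<omega>) (\<lambda>\<omega>. ?r n \<omega> + c * ?i n \<omega>)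
        \<le> 2 * L2_inner P (?r n) (?r n) + 2 * (c\<^sup>2 * L2_inner P (?i n) (?i n))"
      unfolding c[symmetric]
      by (intro always_eventually allI L2_inner_add_self_le residual_L2[OF add.hyps(1)]
          L2_cmult[OF i])
  qed (simp add: L2_inner_self_nonneg)
qed

section \<open>Expansion coefficients and Bessel's inequality\<close>

text \<open>The inner product of \<open>Y i\<close> with the residual no longer changes once
  \<open>n\<close> reaches \<open>i\<close>, yet tends to 0 by Cauchy--Schwarz; hence its eventual
  value is 0.\<close>

lemma inner_coefficient:
  assumes G: "step_pair M g G"
  shows "L2_inner P G (Y i) = v i * signed_integral (\<mu> i) g"
proof -
  let ?r = "\<lambda>n. residual n g G"
  have "(\<lambda>n. L2_inner P (?r n) (?r n) * L2_inner P (Y i) (Y i)) \<longlonglongrightarrow> 0"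
    by (intro tendsto_mult_left_zero residual_tendsto G)
  then have "(\<lambda>n. (L2_inner P (?r n) (Y i))\<^sup>2) \<longlonglongrightarrow> 0"
    by (rule tendsto_sandwich[OF _ _ tendsto_const, rotated 2])
       (auto intro!: always_eventually L2_Cauchy_Schwarz residual_L2 G Y_L2)
  then have lim: "(\<lambda>n. L2_inner P (?r n) (Y i)) \<longlonglongrightarrow> 0"
    by (simp add: power_tendsto_0_iff)
  have "\<forall>\<^sub>F n in sequentially. L2_inner P (?r n) (Y i) =
      L2_inner P G (Y i) - v i * signed_integral (\<mu> i) g"
    using eventually_ge_at_top[of i]
  proof eventually_elim
    case (elim n)
    have "(\<Sum>j\<le>n. signed_integral (\<mu> j) g * L2_inner P (Y j) (Y i)) =
        (\<Sum>j\<le>n. if j = i then signed_integral (\<mu> i) g * v i else 0)"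
      by (intro sum.cong) (auto simp: Y_inner)
    then show ?case using elim by (simp add: residual_inner[OF G Y_L2])
  qed
  then have "(\<lambda>n. L2_inner P (?r n) (Y i)) \<longlonglongrightarrow> L2_inner P G (Y i) - v i * signed_integral (\<mu> i) g"
    by (rule tendsto_eventually)
  from LIMSEQ_unique[OF this lim] show ?thesis by simp
qed

text \<open>The coefficient identity for the indicator of \<open>B\<close> rewrites
  \<open>v j * \<mu> j B\<close> as the inner product of \<open>Y j\<close> and \<open>M B\<close>,
  which exposes the defect as an inner product with \<open>M B\<close>.\<close>

lemma defect_eq_inner:
  assumes "step_pair M g G" "B \<in> bounded_borel"
  shows "defect n g B = L2_inner P (residual n g G) (M B)"
  using assms inner_coefficient[OF step_pair_indicator[OF assms(2)]]
  by (simp add: defect_def residual_inner[OF assms(1) M_L2] step_pair_inner_indicator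
      L2_inner_commute[of P "Y _"] signed_integral_indicator[OF \<mu>_finite] mult_ac)

text \<open>Bessel's inequality for the non-normalised orthogonal system \<open>Y\<close>: the
  residual is orthogonal to \<open>Y 0, ..., Y n\<close>, so its squared norm is that of
  \<open>G\<close> minus a sum of nonnegative terms.\<close>

lemma residual_norm_le:
  assumes G: "step_pair M g G"
  shows "L2_inner P (residual n g G) (residual n g G) \<le> L2_inner P G G"
proof -
  let ?r = "residual n g G"
  note r = residual_L2[OF G, of n]
  have coeff: "L2_inner P (Y i) ?r = 0" if "i \<le> n" for i
  proof -
    have "(\<Sum>j\<le>n. signed_integral (\<mu> j) g * L2_inner P (Y j) (Y i)) =
        (\<Sum>j\<le>n. if j = i then signed_integral (\<mu> i) g * v i else 0)"
      by (intro sum.cong) (auto simp: Y_inner)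
    then show ?thesis
      using that inner_coefficient[OF G, of i]
      by (simp add: L2_inner_commute[of P "Y i" ?r] residual_inner[OF G Y_L2])
  qed
  have "L2_inner P ?r ?r = L2_inner P G ?r"
    using coeff by (simp add: residual_inner[OF G r])
  also have "\<dots> = L2_inner P G G - (\<Sum>j\<le>n. v j * (signed_integral (\<mu> j) g)\<^sup>2)"
    by (simp add: L2_inner_commute[of P G ?r] residual_inner[OF G step_pair_L2[OF G]]
        L2_inner_commute[of P "Y _" G] inner_coefficient[OF G] power2_eq_square mult_ac)
  also have "\<dots> \<le> L2_inner P G G"
    using v_nonneg by (simp add: sum_nonneg)
  finally show ?thesis .
qed

definition total_mass :: real where
  "total_mass = measure (variation C) UNIV"

text \<open>The bound is free of \<open>B\<close>, since \<open>M B\<close> has squared norm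
  \<open>C (B \<times> B)\<close>, which the total mass dominates.\<close>

lemma defect_squared_le:
  assumes "step_pair M g G" "B \<in> bounded_borel"
  shows "(defect n g B)\<^sup>2 \<le> L2_inner P (residual n g G) (residual n g G) * total_mass"
proof -
  have "L2_inner P (M B) (M B) \<le> total_mass"
    using abs_signed_measure_le[OF C_finite bounded_borel_Times[OF assms(2,2)]]
    by (simp add: M_inner assms total_mass_def)
  then show ?thesis
    unfolding defect_eq_inner[OF assms]
    by (intro order_trans[OF L2_Cauchy_Schwarz] mult_left_mono residual_L2 M_L2 assms
        L2_inner_self_nonneg)
qed

lemma defect_diff:
  assumes "bounded_borel_fun f" "bounded_borel_fun g" "B \<in> sets borel"
  shows "defect n (\<lambda>x. f x - g x) B = defect n f B - defect n g B"
proof -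
  have m: "signed_integral (\<mu> j) (\<lambda>x. f x - g x) =
      signed_integral (\<mu> j) f - signed_integral (\<mu> j) g" for j
    using signed_integral_add[OF \<mu>_finite assms(1) bounded_borel_fun_cmult[OF assms(2)], of j "-1"]
      signed_integral_cmult[OF \<mu>_finite, of j "-1" g]
    by simp
  note t = bounded_borel_fun_tensor[OF assms(1) bounded_borel_fun_indicator[OF assms(3)]]
    bounded_borel_fun_tensor[OF assms(2) bounded_borel_fun_indicator[OF assms(3)]]
  have "tensor (\<lambda>x. f x - g x) (indicator B) =
      (\<lambda>z. tensor f (indicator B) z + -1 * tensor g (indicator B) z)"
    by (auto simp: tensor_def algebra_simps)
  then have "signed_integral C (tensor (\<lambda>x. f x - g x) (indicator B)) =
      signed_integral C (tensor f (indicator B)) - signed_integral C (tensor g (indicator B))"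
    using signed_integral_add[OF C_finite t(1) bounded_borel_fun_cmult[OF t(2)], of "-1"]
      signed_integral_cmult[OF C_finite, of "-1" "tensor g (indicator B)"]
    by simp
  then show ?thesis
    by (simp add: defect_def m right_diff_distrib left_diff_distrib sum_subtractf)
qed

section \<open>From step functions to bounded Borel functions\<close>

lemma defect_tendsto:
  assumes "\<And>k. f k \<in> borel_measurable borel" "\<And>k x. \<bar>f k x\<bar> \<le> b"
    "\<And>x. (\<lambda>k. f k x) \<longlonglongrightarrow> g x" "B \<in> sets borel"
  shows "(\<lambda>k. defect n (f k) B) \<longlonglongrightarrow> defect n g B"
  unfolding defect_def
proof (intro tendsto_intros)
  have "\<bar>indicator B x :: real\<bar> \<le> 1" for x by (simp add: indicator_def)
  then show "(\<lambda>k. signed_integral C (tensor (f k) (indicator B))) \<longlonglongrightarrow>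
      signed_integral C (tensor g (indicator B))"
    using assms by (intro tensor_bounded_convergence[where b = b and c = 1]) auto
  show "(\<lambda>k. signed_integral (\<mu> j) (f k)) \<longlonglongrightarrow> signed_integral (\<mu> j) g" for j
    by (rule signed_integral_bounded_convergence[OF \<mu>_finite assms(1-3)])
qed

text \<open>Split \<open>\<phi>\<close> into a step function \<open>g k\<close> and an error
  \<open>d k\<close>. The defect of the error is small uniformly in \<open>n\<close> and
  \<open>B\<close> once \<open>k\<close> is large; with that \<open>k\<close> fixed, the defect of
  \<open>g k\<close> tends to 0 uniformly in \<open>B\<close>.\<close>

lemma defect_uniform_limit:
  assumes \<phi>: "bounded_borel_fun \<phi>" and \<epsilon>: "0 < \<epsilon>"
  shows "\<forall>\<^sub>F n in sequentially. \<forall>B\<in>bounded_borel. \<bar>defect n \<phi> B\<bar> \<le> \<epsilon>"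
proof -
  obtain g G b where g: "\<And>k. step_pair M (g k) (G k)" "\<And>k x. \<bar>g k x\<bar> \<le> b" "\<And>x. \<bar>\<phi> x\<bar> \<le> b"
      "\<And>x. (\<lambda>k. g k x) \<longlonglongrightarrow> \<phi> x"
    using step_pair_approximation[OF \<phi>, of M] by blast
  have gb: "bounded_borel_fun (g k)" for k by (rule bounded_borel_fun_step_pair[OF g(1)])
  have gm: "g k \<in> borel_measurable borel" for k using gb by (simp add: bounded_borel_fun_def)
  have \<phi>m: "\<phi> \<in> borel_measurable borel" using \<phi> by (simp add: bounded_borel_fun_def)
  define d where "d k x = \<phi> x - g k x" for k x
  have db: "\<bar>d k x\<bar> \<le> 2 * b" for k x using g(2)[of k x] g(3)[of x] by (simp add: d_def)
  have dm: "d k \<in> borel_measurable borel" for k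
    unfolding d_def by (intro borel_measurable_diff \<phi>m gm)
  have d0: "(\<lambda>k. d k x) \<longlonglongrightarrow> 0" for x
    using tendsto_diff[OF tendsto_const[of "\<phi> x"] g(4)[of x]] by (simp add: d_def)
  \<comment> \<open>This plays the part of the squared norm of the stochastic integral of
    \<open>d k\<close>.\<close>
  let ?\<delta> = "\<lambda>k. signed_integral C (tensor (d k) (d k))"
  have "?\<delta> \<longlonglongrightarrow> signed_integral C (tensor (\<lambda>_. 0) (\<lambda>_. 0))"
    by (rule tensor_bounded_convergence[OF dm dm db db d0 d0])
  from tendsto_mult_right[OF this, of total_mass]
  have "(\<lambda>k. ?\<delta> k * total_mass) \<longlonglongrightarrow> 0" by (simp add: tensor_simps)
  moreover have "0 < (\<epsilon> / 2)\<^sup>2" using \<epsilon> by simp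
  ultimately have "\<forall>\<^sub>F k in sequentially. ?\<delta> k * total_mass < (\<epsilon> / 2)\<^sup>2" by (rule order_tendstoD)
  then obtain k where k: "?\<delta> k * total_mass < (\<epsilon> / 2)\<^sup>2" by (auto simp: eventually_sequentially)
  have far: "\<bar>defect n (d k) B\<bar> \<le> \<epsilon> / 2" if B: "B \<in> bounded_borel" for n B
  proof -
    have Bb: "B \<in> sets borel" by (rule bounded_borel_sets[OF B])
    \<comment> \<open>No random variable is attached to \<open>d k\<close>, so Bessel's inequality
      is applied to the step functions \<open>h l\<close>, which converge to \<open>d k\<close>, and
      the resulting bound is passed to the limit in \<open>l\<close>.\<close>
    define h where "h l x = g l x - g k x" for l x
    have hp: "step_pair M (h l) (\<lambda>\<omega>. G l \<omega> - G k \<omega>)" for l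
      unfolding h_def by (rule step_pair_diff[OF g(1) g(1)])
    have hm: "h l \<in> borel_measurable borel" for l
      unfolding h_def by (intro borel_measurable_diff gm)
    have hb: "\<bar>h l x\<bar> \<le> 2 * b" for l x
      using g(2)[of l x] g(2)[of k x] by (simp add: h_def)
    have hd: "(\<lambda>l. h l x) \<longlonglongrightarrow> d k x" for x
      unfolding h_def d_def by (intro tendsto_diff g(4) tendsto_const)
    have "(defect n (h l) B)\<^sup>2 \<le> signed_integral C (tensor (h l) (h l)) * total_mass" for l
    proof -
      have "0 \<le> total_mass" by (simp add: total_mass_def)
      then show ?thesis
        using defect_squared_le[OF hp B, of n l] mult_right_mono[OF residual_norm_le[OF hp, of n l]]
        unfolding step_pair_isometry[OF hp hp] by (blast intro: order_trans)
    qed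
    moreover have "(\<lambda>l. (defect n (h l) B)\<^sup>2) \<longlonglongrightarrow> (defect n (d k) B)\<^sup>2"
      by (intro tendsto_power defect_tendsto[OF hm hb hd Bb])
    moreover have "(\<lambda>l. signed_integral C (tensor (h l) (h l)) * total_mass) \<longlonglongrightarrow> ?\<delta> k * total_mass"
      by (intro tendsto_mult_right tensor_bounded_convergence[OF hm hm hb hb hd hd])
    ultimately have "(defect n (d k) B)\<^sup>2 \<le> ?\<delta> k * total_mass"
      by (intro LIMSEQ_le[of "\<lambda>l. (defect n (h l) B)\<^sup>2"]) auto
    with k have "(defect n (d k) B)\<^sup>2 \<le> (\<epsilon> / 2)\<^sup>2" by linarith
    then show ?thesis using \<epsilon> by (simp add: power2_le_iff_abs_le)
  qed
  let ?r = "\<lambda>n. L2_inner P (residual n (g k) (G k)) (residual n (g k) (G k)) * total_mass"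
  have "?r \<longlonglongrightarrow> 0"
    using tendsto_mult_right[OF residual_tendsto[OF g(1)[of k]], of total_mass] by simp
  then have "\<forall>\<^sub>F n in sequentially. ?r n < (\<epsilon> / 2)\<^sup>2"
    by (rule order_tendstoD) (use \<epsilon> in simp)
  then show ?thesis
  proof eventually_elim
    case (elim n)
    show ?case
    proof
      fix B :: "'a set" assume B: "B \<in> bounded_borel"
      have "(defect n (g k) B)\<^sup>2 \<le> (\<epsilon> / 2)\<^sup>2"
        using defect_squared_le[OF g(1)[of k] B, of n] elim by linarith
      then have near: "\<bar>defect n (g k) B\<bar> \<le> \<epsilon> / 2"
        using \<epsilon> by (simp add: power2_le_iff_abs_le)
      have "defect n (d k) B = defect n \<phi> B - defect n (g k) B"
        unfolding d_def by (rule defect_diff[OF \<phi> gb bounded_borel_sets[OF B]])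
      then show "\<bar>defect n \<phi> B\<bar> \<le> \<epsilon>" using far[OF B, of n] near by linarith
    qed
  qed
qed

lemma signed_measure_defect:
  assumes "bounded_borel_fun \<phi>"
  shows "signed_measure (defect n \<phi>)"
proof -
  have "signed_measure (\<mu> j)" for j using \<mu>_finite by (simp add: finite_signed_measure_def)
  then show ?thesis
    unfolding defect_def[abs_def]
    by (intro signed_measure_diff_sum signed_measure_tensor_indicator C_finite assms)
qed

lemma variation_defect_tendsto:
  assumes "bounded_borel_fun \<phi>"
  shows "(\<lambda>n. emeasure (variation (defect n \<phi>)) UNIV) \<longlonglongrightarrow> 0"
proof (rule order_tendstoI)
  fix a :: ennreal assume "0 < a"
  \<comment> \<open>\<open>a\<close> may be infinite; anything strictly below it is a real
    number.\<close>
  then obtain b where b: "0 < b" "b < a" using dense by blast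
  then obtain e where e: "0 < e" "ennreal e < a" by (cases b) (auto simp: ennreal_less_zero_iff)
  \<comment> \<open>Half of \<open>e\<close> compensates the factor 2 in
    \<open>variation_UNIV_le\<close>.\<close>
  have "\<forall>\<^sub>F n in sequentially. \<forall>B\<in>bounded_borel. \<bar>defect n \<phi> B\<bar> \<le> e / 2"
    using assms e by (intro defect_uniform_limit) auto
  then show "\<forall>\<^sub>F n in sequentially. emeasure (variation (defect n \<phi>)) UNIV < a"
  proof eventually_elim
    case (elim n)
    from variation_UNIV_le[OF signed_measure_defect[OF assms], of n "e / 2"] elim e
    show ?case by (auto intro: order_le_less_trans)
  qed
qed simp

end

section \<open>Reduction of the theorem to the centred orthogonal expansion\<close>

theorem proposition3p1:
  fixes P :: "'w measure"
    and M :: "(real ^ 'd) set \<Rightarrow> 'w \<Rightarrow> real"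
    and C :: "((real ^ 'd) \<times> (real ^ 'd)) set \<Rightarrow> real"
    and X :: "nat \<Rightarrow> 'w \<Rightarrow> real"
    and \<mu> :: "nat \<Rightarrow> (real ^ 'd) set \<Rightarrow> real"
    and \<phi> :: "real ^ 'd \<Rightarrow> real"
  assumes "prob_space P"
    and "m_cov_random_measure P M"
    and "covariance_measure P M C"
    and "finite_signed_measure C"
    and "\<And>n. X n \<in> L2 P"
    and "\<And>i j. i \<noteq> j \<Longrightarrow> uncorrelated P (X i) (X j)"
    and "summable (\<lambda>n. prob_space.variance P (X n))"
    and "\<And>n. finite_signed_measure (\<mu> n)"
    and "lin_indep_measures \<mu>"
    and "\<And>\<psi>. \<psi> \<in> borel_measurable borel \<Longrightarrow> bounded (range \<psi>) \<Longrightarrow>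
           mean_square_limit P (\<lambda>n \<omega>. \<Sum>j\<le>n. X j \<omega> * signed_integral (\<mu> j) \<psi>)
             (rm_integral P M \<psi>)"
    and "\<phi> \<in> borel_measurable borel" and "bounded (range \<phi>)"
  shows "(\<lambda>n. emeasure
            (variation (\<lambda>B. signed_integral C (tensor \<phi> (indicator B)) -
               (\<Sum>j\<le>n. prob_space.variance P (X j) * signed_integral (\<mu> j) \<phi> * \<mu> j B)))
            UNIV) \<longlonglongrightarrow> 0"
proof -
  interpret prob_space P by fact
  note X = assms(5) and \<mu> = assms(8)
  have M: "M A \<in> L2 P" "expectation (M A) = 0" if "A \<in> bounded_borel" for A
    using assms(2) that by (auto simp: m_cov_random_measure_def)
  interpret covariance_isometry P M C
    by unfold_locales
      (use assms(3,4) M in \<open>auto simp: covariance_measure_def L2_inner_def\<close>)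
  \<comment> \<open>Centring turns pairwise uncorrelated into pairwise orthogonal, with the
    variances as squared norms.\<close>
  define Y where "Y j = (\<lambda>\<omega>. X j \<omega> - expectation (X j))" for j
  have Y: "Y j \<in> L2 P" for j
    unfolding Y_def using X by (intro L2_diff L2_const)
  have "uncorrelated_expansion P M C Y (\<lambda>j. variance (X j)) \<mu>"
  proof unfold_locales
    show "L2_inner P (Y i) (Y j) = (if i = j then variance (X j) else 0)" for i j
      using assms(6)[of i j] by (simp add: L2_inner_def Y_def uncorrelated_def power2_eq_square)
    fix A :: "(real ^ 'd) set" assume A: "A \<in> bounded_borel"
    let ?Z = "rm_integral P M (indicator A)"
    let ?S = "\<lambda>n \<omega>. \<Sum>j\<le>n. X j \<omega> * \<mu> j A"
    let ?D = "\<lambda>n \<omega>. M A \<omega> - (\<Sum>j\<le>n. \<mu> j A * Y j \<omega>)"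
    note Z = rm_integral_indicator[OF A]
    have "bounded_borel_fun (indicator A :: real ^ 'd \<Rightarrow> real)"
      by (rule bounded_borel_fun_indicator[OF bounded_borel_sets[OF A]])
    then have "mean_square_limit P (\<lambda>n \<omega>. \<Sum>j\<le>n. X j \<omega> * signed_integral (\<mu> j) (indicator A)) ?Z"
      unfolding bounded_borel_fun_def by (intro assms(10)) auto
    then have ms: "mean_square_limit P ?S ?Z"
      by (simp only: signed_integral_indicator[OF \<mu> A])
    have S: "?S n \<in> L2 P" for n using ms by (auto simp: mean_square_limit_def)
    let ?E = "\<lambda>n \<omega>. ?S n \<omega> - ?Z \<omega>"
    \<comment> \<open>The \<open>X j\<close> need not be centred; since \<open>M A\<close> is, passing from \<open>X j\<close> to \<open>Y j\<close> only subtracts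
      the mean from the error of approximation.\<close>
    have le: "L2_inner P (?D n) (?D n) \<le> 2 * L2_inner P (?E n) (?E n)" for n
    proof -
      let ?R = "\<lambda>\<omega>. M A \<omega> - ?S n \<omega>"
      have R: "?R \<in> L2 P" using M(1)[OF A] S by (rule L2_diff)
      have intX: "integrable P (X j)" for j by (rule L2_integrable[OF X])
      have ER: "expectation ?R = - (\<Sum>j\<le>n. expectation (X j) * \<mu> j A)"
        using L2_integrable[OF M(1)[OF A]] intX M(2)[OF A] by simp
      have D: "?D n = (\<lambda>\<omega>. ?R \<omega> - expectation ?R)"
        unfolding ER
        by (auto simp: Y_def fun_eq_iff algebra_simps sum_subtractf)
      have "L2_inner P (?D n) (?D n) = variance ?R"
        unfolding D by (simp add: L2_inner_self)
      also have "\<dots> = L2_inner P ?R ?R - (expectation ?R)\<^sup>2"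
        using R L2_integrable[OF R] by (subst variance_eq) (auto simp: L2_inner_self L2_def)
      also have "\<dots> \<le> L2_inner P ?R ?R" by simp
      also have "\<dots> = L2_inner P (\<lambda>\<omega>. ?E n \<omega> + (?Z \<omega> - M A \<omega>)) (\<lambda>\<omega>. ?E n \<omega> + (?Z \<omega> - M A \<omega>))"
        by (simp add: L2_inner_self power2_commute)
      also have "\<dots> \<le> 2 * L2_inner P (?E n) (?E n) +
          2 * L2_inner P (\<lambda>\<omega>. ?Z \<omega> - M A \<omega>) (\<lambda>\<omega>. ?Z \<omega> - M A \<omega>)"
        by (rule L2_inner_add_self_le[OF L2_diff[OF S Z(1)] L2_diff[OF Z(1) M(1)[OF A]]])
      finally show ?thesis by (simp only: Z(2))
    qed
    show "(\<lambda>n. L2_inner P (?D n) (?D n)) \<longlonglongrightarrow> 0"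
    proof (rule tendsto_sandwich[OF _ _ tendsto_const])
      show "(\<lambda>n. 2 * L2_inner P (?E n) (?E n)) \<longlonglongrightarrow> 0"
        using ms by (intro tendsto_mult_right_zero) (simp add: mean_square_limit_def L2_inner_self)
    qed (use le in \<open>auto simp: L2_inner_self_nonneg\<close>)
  qed (use Y \<mu> in auto)
  then interpret uncorrelated_expansion P M C Y "\<lambda>j. variance (X j)" \<mu> .
  have "bounded_borel_fun \<phi>" using assms(11,12) by (simp add: bounded_borel_fun_def)
  from variation_defect_tendsto[OF this] show ?thesis
    by (simp only: defect_def[abs_def])
qed

end
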